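(* Consider the Range Subgraph Counting problem with pattern $Q=$ wedge (the path with 2 edges). For any real value $\lambda \in [1,\sqrt{m}]$, there is a data structure of $\tilde{O}(m^2/\lambda^2)$ space that answers a query in $\tilde{O}(\lambda)$ time.
   Context: Range Subgraph Counting: $G=(V,E)$ is an undirected graph with $n=|V|$ and $m=|E|$, where each vertex $v\in V$ carries a real-valued attribute $A_v$. For an interval $q=[x_1,x_2]$, let $V_q=\{v\in V \mid x_1\le A_v\le x_2\}$ and let $G_q$ be the subgraph of $G$ induced by $V_q$. A fixed connected pattern graph $Q$ with $O(1)$ vertices is given; an occurrence of $Q$ is a subgraph isomorphic to $Q$. A query, given an interval $q$, returns the number of occurrences of $Q$ in $G_q$. The structure is built on $G$ in advance (model: RAM). The notation $\tilde{O}(\cdot)$ hides factors polylogarithmic in the problem parameters. *)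

theory Defs
  imports Complex_Main
begin

record 'v ugraph =
  verts :: "'v set"
  edges :: "'v set set"

definition simple_graph :: "'v ugraph \<Rightarrow> bool" where
  "simple_graph G \<longleftrightarrow> finite (verts G) \<and> (\<forall>e\<in>edges G. e \<subseteq> verts G \<and> card e = 2)"

definition subgraph :: "'v ugraph \<Rightarrow> 'v ugraph \<Rightarrow> bool" where
  "subgraph H G \<longleftrightarrow> simple_graph H \<and> verts H \<subseteq> verts G \<and> edges H \<subseteq> edges G"

definition induced :: "'v ugraph \<Rightarrow> 'v set \<Rightarrow> 'v ugraph" where
  "induced G U = \<lparr>verts = U, edges = {e \<in> edges G. e \<subseteq> U}\<rparr>"

definition isomorphic :: "'u ugraph \<Rightarrow> 'v ugraph \<Rightarrow> bool" where
  "isomorphic G H \<longleftrightarrow>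
     (\<exists>f. bij_betw f (verts G) (verts H) \<and> edges H = (\<lambda>e. f ` e) ` edges G)"

definition occurrences :: "'u ugraph \<Rightarrow> 'v ugraph \<Rightarrow> 'v ugraph set" where
  "occurrences Q G = {H. subgraph H G \<and> isomorphic Q H}"

definition wedge :: "nat ugraph" where
  "wedge = \<lparr>verts = {0, 1, 2}, edges = {{0, 1}, {1, 2}}\<rparr>"

definition range_verts :: "'v ugraph \<Rightarrow> ('v \<Rightarrow> real) \<Rightarrow> real \<Rightarrow> real \<Rightarrow> 'v set" where
  "range_verts G A x1 x2 = {v \<in> verts G. x1 \<le> A v \<and> A v \<le> x2}"

definition range_count ::
    "'u ugraph \<Rightarrow> 'v ugraph \<Rightarrow> ('v \<Rightarrow> real) \<Rightarrow> real \<Rightarrow> real \<Rightarrow> nat" where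
  "range_count Q G A x1 x2 = card (occurrences Q (induced G (range_verts G A x1 x2)))"

text \<open>
  A unit-cost RAM with words of \<open>w\<close> bits (naturals below \<open>2 ^ w\<close>, arithmetic modulo
  \<open>2 ^ w\<close>). Since attributes and query endpoints are real, there is a second bank of
  registers and a second memory array that hold reals; reals can be copied and compared,
  but no arithmetic on them and no conversion between reals and words is available, so that
  a real cell cannot be used to pack or unpack information.

  Register names are part of the (fixed, finite) program text, so a program uses only
  constantly many registers. Memory is addressed indirectly: \<open>Load r a\<close> reads the word
  cell whose address is the content of register \<open>a\<close>, and \<open>Store a r\<close> writes the content
  of register \<open>r\<close> to that cell; \<open>RLoad\<close> and \<open>RStore\<close> do the same with a real cell.
\<close>

datatype instr =
    Const nat nat
  | Move nat nat
  | Add nat nat nat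
  | Sub nat nat nat
  | Mul nat nat nat
  | Div nat nat nat
  | Load nat nat
  | Store nat nat
  | RMove nat nat
  | RLoad nat nat
  | RStore nat nat
  | Jump nat
  | JumpLess nat nat nat
  | JumpEq nat nat nat
  | RJumpLess nat nat nat
  | RJumpEq nat nat nat
  | Halt

type_synonym program = "instr list"

record state =
  pc :: nat
  reg :: "nat \<Rightarrow> nat"
  rreg :: "nat \<Rightarrow> real"
  wmem :: "nat list"
  rmem :: "real list"

definition set_reg :: "nat \<Rightarrow> nat \<Rightarrow> state \<Rightarrow> state" where
  "set_reg r x s = s\<lparr>pc := Suc (pc s), reg := (reg s)(r := x)\<rparr>"

definition set_rreg :: "nat \<Rightarrow> real \<Rightarrow> state \<Rightarrow> state" where
  "set_rreg r x s = s\<lparr>pc := Suc (pc s), rreg := (rreg s)(r := x)\<rparr>"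

definition branch :: "bool \<Rightarrow> nat \<Rightarrow> state \<Rightarrow> state" where
  "branch b l s = s\<lparr>pc := (if b then l else Suc (pc s))\<rparr>"

text \<open>
  \<open>None\<close> means that no further step is possible: either the program has halted, or it is
  stuck because it accessed a cell outside the allocated memory. As the two arrays never
  change their length, their lengths account for all memory a computation can use,
  working space included.
\<close>

fun exec_instr :: "nat \<Rightarrow> instr \<Rightarrow> state \<Rightarrow> state option" where
  "exec_instr w (Const r k) s = Some (set_reg r (k mod 2 ^ w) s)"
| "exec_instr w (Move r a) s = Some (set_reg r (reg s a) s)"
| "exec_instr w (Add r a b) s = Some (set_reg r ((reg s a + reg s b) mod 2 ^ w) s)"
| "exec_instr w (Sub r a b) s = Some (set_reg r ((reg s a + 2 ^ w - reg s b) mod 2 ^ w) s)"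
| "exec_instr w (Mul r a b) s = Some (set_reg r ((reg s a * reg s b) mod 2 ^ w) s)"
| "exec_instr w (Div r a b) s = Some (set_reg r (reg s a div reg s b) s)"
| "exec_instr w (Load r a) s =
     (if reg s a < length (wmem s) then Some (set_reg r (wmem s ! reg s a) s) else None)"
| "exec_instr w (Store a r) s =
     (if reg s a < length (wmem s)
      then Some (s\<lparr>pc := Suc (pc s), wmem := (wmem s)[reg s a := reg s r]\<rparr>) else None)"
| "exec_instr w (RMove r a) s = Some (set_rreg r (rreg s a) s)"
| "exec_instr w (RLoad r a) s =
     (if reg s a < length (rmem s) then Some (set_rreg r (rmem s ! reg s a) s) else None)"
| "exec_instr w (RStore a r) s =
     (if reg s a < length (rmem s)
      then Some (s\<lparr>pc := Suc (pc s), rmem := (rmem s)[reg s a := rreg s r]\<rparr>) else None)"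
| "exec_instr w (Jump l) s = Some (branch True l s)"
| "exec_instr w (JumpLess a b l) s = Some (branch (reg s a < reg s b) l s)"
| "exec_instr w (JumpEq a b l) s = Some (branch (reg s a = reg s b) l s)"
| "exec_instr w (RJumpLess a b l) s = Some (branch (rreg s a < rreg s b) l s)"
| "exec_instr w (RJumpEq a b l) s = Some (branch (rreg s a = rreg s b) l s)"
| "exec_instr w Halt s = None"

definition step :: "nat \<Rightarrow> program \<Rightarrow> state \<Rightarrow> state option" where
  "step w P s = (if pc s < length P then exec_instr w (P ! pc s) s else None)"

fun steps :: "nat \<Rightarrow> program \<Rightarrow> nat \<Rightarrow> state \<Rightarrow> state option" where
  "steps w P 0 s = Some s"
| "steps w P (Suc t) s = (case step w P s of None \<Rightarrow> None | Some s' \<Rightarrow> steps w P t s')"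

definition halted :: "program \<Rightarrow> state \<Rightarrow> bool" where
  "halted P s \<longleftrightarrow> pc s < length P \<and> P ! pc s = Halt"

text \<open>The memory contents left behind by preprocessing: the word array and the real array.\<close>

type_synonym image = "nat list \<times> real list"

definition valid_image :: "nat \<Rightarrow> image \<Rightarrow> bool" where
  "valid_image w D \<longleftrightarrow> (\<forall>x\<in>set (fst D). x < 2 ^ w)"

definition space :: "image \<Rightarrow> nat" where
  "space D = length (fst D) + length (snd D)"

definition query_state :: "image \<Rightarrow> real \<Rightarrow> real \<Rightarrow> state" where
  "query_state D x1 x2 =
     \<lparr>pc = 0, reg = (\<lambda>_. 0), rreg = (\<lambda>_. 0)(0 := x1, 1 := x2), wmem = fst D, rmem = snd D\<rparr>"

text \<open>
  The answer is delivered in register 0. The memory must be back in its initial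
  state at the end, so that the structure remains usable for further queries.
\<close>

definition answers :: "nat \<Rightarrow> program \<Rightarrow> image \<Rightarrow> real \<Rightarrow> real \<Rightarrow> real \<Rightarrow> nat \<Rightarrow> bool" where
  "answers w P D x1 x2 T a \<longleftrightarrow>
     (\<exists>t s. real t \<le> T \<and> steps w P t (query_state D x1 x2) = Some s \<and> halted P s \<and>
            reg s 0 = a \<and> (wmem s, rmem s) = D)"

definition range_counting_structure ::
    "'u ugraph \<Rightarrow> 'v ugraph \<Rightarrow> ('v \<Rightarrow> real) \<Rightarrow> nat \<Rightarrow> program \<Rightarrow> image \<Rightarrow> real \<Rightarrow> real \<Rightarrow> bool" where
  "range_counting_structure Q G A w P D S T \<longleftrightarrow>
     valid_image w D \<and> real (space D) \<le> S \<and>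
     (\<forall>x1 x2. x1 \<le> x2 \<longrightarrow> answers w P D x1 x2 T (range_count Q G A x1 x2))"

definition log_size :: "'v ugraph \<Rightarrow> real" where
  "log_size G = log 2 (real (card (verts G) + card (edges G)))"

text \<open>Words of \<open>\<Theta>(log (n + m))\<close> bits.\<close>

definition word_length :: "nat \<Rightarrow> 'v ugraph \<Rightarrow> nat" where
  "word_length c G = c * nat \<lceil>log_size G\<rceil>"

end

theory Submission
  imports Defs
begin

text \<open>
  Sort the non-isolated vertices by attribute and replace them by their ranks. Writing the
  sorted adjacency lists one after the other gives a sequence of \<open>2m\<close> incidences, which is
  cut into blocks of length \<open>l \<approx> \<lambda>\<close>. A vertex whose own list crosses a cut contributes both
  its ends as boundaries, so there are only \<open>O(m/\<lambda>)\<close> boundaries, and the answers for all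
  pairs of boundaries fit into \<open>O(m\<^sup>2/\<lambda>\<^sup>2)\<close> words. A query range exceeds the largest range between
  boundaries inside it by vertices of total degree less than \<open>2l\<close>. These are added
  one by one: a new vertex \<open>u\<close> creates one wedge for every pair of its neighbours in the
  current range, and \<open>d(v)\<close> wedges for every such neighbour \<open>v\<close>, where \<open>d(v)\<close> is the degree
  of \<open>v\<close> within the range and is found by binary search.
\<close>

section \<open>Structured programs for the RAM\<close>

text \<open>The cuts count incidences because adding a vertex costs time proportional to its degree.
  A single vertex may have degree far above \<open>l\<close>, and a query ending next to it could
  not afford to add it; making both of its ends boundaries ensures that only vertices whose lists
  stay strictly inside a block are ever added. Dropping isolated vertices makes every degree
  positive, so that the fixed number of searches per added vertex can also be charged to its degree,
  and it bounds the number of stored reals by \<open>2 * m\<close>. The condition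
  \<open>\<lambda> \<le> sqrt m\<close> means \<open>m \<le> m\<^sup>2 / \<lambda>\<^sup>2\<close>,
  so the incidences and reals, which take linear space, fit beside the table. Degrees within a range
  change as the range grows, hence the searches instead of stored degrees. One program text has to
  serve all graphs: every size is read from a header of the image. The program only reads memory, so
  the image can stay a fixed parameter of the program logic, and step counts are carried in the
  postcondition.\<close>

datatype test = Less nat nat | RLess nat nat

datatype com =
    Do instr
  | Seq com com  (infixr ";;" 60)
  | Ite test com com
  | While test com

fun jump :: "test \<Rightarrow> nat \<Rightarrow> instr" where
  "jump (Less a b) l = JumpLess a b l"
| "jump (RLess a b) l = RJumpLess a b l"

fun holds :: "test \<Rightarrow> (nat \<Rightarrow> nat) \<Rightarrow> (nat \<Rightarrow> real) \<Rightarrow> bool" where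
  "holds (Less a b) R X \<longleftrightarrow> R a < R b"
| "holds (RLess a b) R X \<longleftrightarrow> X a < X b"

fun code_length :: "com \<Rightarrow> nat" where
  "code_length (Do i) = 1"
| "code_length (c ;; d) = code_length c + code_length d"
| "code_length (Ite b c d) = code_length c + code_length d + 2"
| "code_length (While b c) = code_length c + 3"

text \<open>Only successful tests jump, so the else branch directly follows the test and needs a
  closing \<open>Jump\<close>; this gives the surcharges of one and two steps in
  \<open>wp_Ite\<close>. The start \<open>p\<close> is passed along because jump targets are
  absolute.\<close>

fun compile :: "nat \<Rightarrow> com \<Rightarrow> program" where
  "compile p (Do i) = [i]"
| "compile p (c ;; d) = compile p c @ compile (p + code_length c) d"
| "compile p (Ite b c d) =
     [jump b (p + code_length d + 2)] @ compile (p + 1) d @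
     [Jump (p + code_length d + 2 + code_length c)] @ compile (p + code_length d + 2) c"
| "compile p (While b c) =
     [jump b (p + 2), Jump (p + code_length c + 3)] @ compile (p + 2) c @ [Jump p]"

lemma length_compile [simp]: "length (compile p c) = code_length c"
  by (induction c arbitrary: p) auto

definition code_at :: "program \<Rightarrow> nat \<Rightarrow> program \<Rightarrow> bool" where
  "code_at P p xs \<longleftrightarrow> (\<forall>i<length xs. p + i < length P \<and> P ! (p + i) = xs ! i)"

lemma code_at_Nil [simp]: "code_at P p []"
  by (simp add: code_at_def)

lemma code_at_Cons [simp]:
  "code_at P p (x # xs) \<longleftrightarrow> p < length P \<and> P ! p = x \<and> code_at P (Suc p) xs"
  unfolding code_at_def by (simp add: All_less_Suc2)

lemma code_at_append [simp]:
  "code_at P p (xs @ ys) \<longleftrightarrow> code_at P p xs \<and> code_at P (p + length xs) ys"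
  by (induction xs arbitrary: p) (auto simp: add.commute)

lemma code_at_self: "code_at (xs @ ys) 0 xs"
  by (auto simp: code_at_def nth_append)

lemma steps_add:
  "steps w P (t1 + t2) s = (case steps w P t1 s of None \<Rightarrow> None | Some s' \<Rightarrow> steps w P t2 s')"
  by (induction t1 arbitrary: s) (auto split: option.splits)

definition machine_state :: "image \<Rightarrow> nat \<Rightarrow> (nat \<Rightarrow> nat) \<Rightarrow> (nat \<Rightarrow> real) \<Rightarrow> state" where
  "machine_state D p R X = \<lparr>pc = p, reg = R, rreg = X, wmem = fst D, rmem = snd D\<rparr>"

text \<open>
  Weakest preconditions of total correctness for code that never writes to memory.
  The first argument of the postcondition is the exact number of machine steps.
\<close>

definition wp ::
    "nat \<Rightarrow> image \<Rightarrow> com \<Rightarrow> (nat \<Rightarrow> (nat \<Rightarrow> nat) \<Rightarrow> (nat \<Rightarrow> real) \<Rightarrow> bool) \<Rightarrow>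
     (nat \<Rightarrow> nat) \<Rightarrow> (nat \<Rightarrow> real) \<Rightarrow> bool" where
  "wp w D c Q R X \<longleftrightarrow> (\<exists>t R' X'. Q t R' X' \<and>
     (\<forall>P p. code_at P p (compile p c) \<longrightarrow>
        steps w P t (machine_state D p R X) =
          Some (machine_state D (p + code_length c) R' X')))"

lemma wpE:
  assumes "wp w D c Q R X"
  obtains t R' X' where "Q t R' X'"
    "\<And>P p. code_at P p (compile p c) \<Longrightarrow>
      steps w P t (machine_state D p R X) = Some (machine_state D (p + code_length c) R' X')"
  using assms unfolding wp_def by metis

lemma wp_mono:
  assumes "wp w D c Q R X" "\<And>t R' X'. Q t R' X' \<Longrightarrow> Q' t R' X'"
  shows "wp w D c Q' R X"
  using assms unfolding wp_def by blast

lemma wp_Do: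
  assumes "\<And>p. exec_instr w i (machine_state D p R X) = Some (machine_state D (Suc p) R' X')"
    and "Q 1 R' X'"
  shows "wp w D (Do i) Q R X"
proof -
  have "steps w P 1 (machine_state D p R X) = Some (machine_state D (p + code_length (Do i)) R' X')"
    if "code_at P p (compile p (Do i))" for P p
    using that assms(1)[of p] by (simp add: step_def machine_state_def)
  then show ?thesis
    using assms(2) unfolding wp_def by blast
qed

lemma wp_Const:
  assumes "k < 2 ^ w" "Q 1 (R(r := k)) X"
  shows "wp w D (Do (Const r k)) Q R X"
  by (rule wp_Do[where Q = Q, OF _ assms(2)]) (use assms(1) in \<open>simp add: machine_state_def set_reg_def\<close>)

lemma wp_Move:
  assumes "Q 1 (R(r := R a)) X"
  shows "wp w D (Do (Move r a)) Q R X"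
  by (rule wp_Do[where Q = Q, OF _ assms]) (simp add: machine_state_def set_reg_def)

lemma wp_Add:
  assumes "R a + R b < 2 ^ w" "Q 1 (R(r := R a + R b)) X"
  shows "wp w D (Do (Add r a b)) Q R X"
  by (rule wp_Do[where Q = Q, OF _ assms(2)]) (use assms(1) in \<open>simp add: machine_state_def set_reg_def\<close>)

lemma wp_Sub:
  assumes "R b \<le> R a" "R a < 2 ^ w" "Q 1 (R(r := R a - R b)) X"
  shows "wp w D (Do (Sub r a b)) Q R X"
proof (rule wp_Do[where Q = Q, OF _ assms(3)])
  have "(R a + 2 ^ w - R b) mod 2 ^ w = ((R a - R b) + 2 ^ w) mod 2 ^ w"
    using assms(1) by simp
  also have "\<dots> = R a - R b"
    using assms(2) by simp
  finally show "exec_instr w (Sub r a b) (machine_state D p R X) =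
      Some (machine_state D (Suc p) (R(r := R a - R b)) X)" for p
    by (simp add: machine_state_def set_reg_def)
qed

lemma wp_Mul:
  assumes "R a * R b < 2 ^ w" "Q 1 (R(r := R a * R b)) X"
  shows "wp w D (Do (Mul r a b)) Q R X"
  by (rule wp_Do[where Q = Q, OF _ assms(2)]) (use assms(1) in \<open>simp add: machine_state_def set_reg_def\<close>)

lemma wp_Div:
  assumes "Q 1 (R(r := R a div R b)) X"
  shows "wp w D (Do (Div r a b)) Q R X"
  by (rule wp_Do[where Q = Q, OF _ assms]) (simp add: machine_state_def set_reg_def)

lemma wp_Load:
  assumes "R a < length (fst D)" "Q 1 (R(r := fst D ! R a)) X"
  shows "wp w D (Do (Load r a)) Q R X"
  by (rule wp_Do[where Q = Q, OF _ assms(2)]) (use assms(1) in \<open>simp add: machine_state_def set_reg_def\<close>)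

lemma wp_RLoad:
  assumes "R a < length (snd D)" "Q 1 R (X(r := snd D ! R a))"
  shows "wp w D (Do (RLoad r a)) Q R X"
  by (rule wp_Do[where Q = Q, OF _ assms(2)]) (use assms(1) in \<open>simp add: machine_state_def set_rreg_def\<close>)

lemma wp_Seq:
  assumes "wp w D c (\<lambda>t R X. wp w D d (\<lambda>t'. Q (t + t')) R X) R X"
  shows "wp w D (c ;; d) Q R X"
proof -
  from assms obtain t1 R1 X1 where d: "wp w D d (\<lambda>t'. Q (t1 + t')) R1 X1" and c:
    "\<And>P p. code_at P p (compile p c) \<Longrightarrow>
      steps w P t1 (machine_state D p R X) = Some (machine_state D (p + code_length c) R1 X1)"
    by (rule wpE) blast
  from d obtain t2 R2 X2 where Q: "Q (t1 + t2) R2 X2" and d: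
    "\<And>P p. code_at P p (compile p d) \<Longrightarrow>
      steps w P t2 (machine_state D p R1 X1) = Some (machine_state D (p + code_length d) R2 X2)"
    by (rule wpE) blast
  have "steps w P (t1 + t2) (machine_state D p R X) =
      Some (machine_state D (p + code_length (c ;; d)) R2 X2)"
    if "code_at P p (compile p (c ;; d))" for P p
    using that by (simp add: steps_add c d add.assoc)
  with Q show ?thesis
    unfolding wp_def by blast
qed

lemma step_jump:
  assumes "p < length P" "P ! p = jump b l"
  shows "step w P (machine_state D p R X) =
    Some (machine_state D (if holds b R X then l else Suc p) R X)"
  using assms by (cases b) (auto simp: step_def machine_state_def branch_def)

lemma step_Jump:
  assumes "p < length P" "P ! p = Jump l"
  shows "step w P (machine_state D p R X) = Some (machine_state D l R X)"
  using assms by (auto simp: step_def machine_state_def branch_def)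

lemma wp_Ite:
  assumes "holds b R X \<Longrightarrow> wp w D c (\<lambda>t. Q (t + 1)) R X"
    and "\<not> holds b R X \<Longrightarrow> wp w D d (\<lambda>t. Q (t + 2)) R X"
  shows "wp w D (Ite b c d) Q R X"
proof (cases "holds b R X")
  case True
  from assms(1)[OF this] obtain t R' X' where Q: "Q (t + 1) R' X'" and c:
    "\<And>P p. code_at P p (compile p c) \<Longrightarrow>
      steps w P t (machine_state D p R X) = Some (machine_state D (p + code_length c) R' X')"
    by (rule wpE) blast
  have "steps w P (t + 1) (machine_state D p R X) =
      Some (machine_state D (p + code_length (Ite b c d)) R' X')"
    if "code_at P p (compile p (Ite b c d))" for P p
    using that True by (simp add: step_jump c add_ac)
  with Q show ?thesis
    unfolding wp_def by blast
next
  case False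
  from assms(2)[OF this] obtain t R' X' where Q: "Q (t + 2) R' X'" and d:
    "\<And>P p. code_at P p (compile p d) \<Longrightarrow>
      steps w P t (machine_state D p R X) = Some (machine_state D (p + code_length d) R' X')"
    by (rule wpE) blast
  have "steps w P (1 + (t + 1)) (machine_state D p R X) =
      Some (machine_state D (p + code_length (Ite b c d)) R' X')"
    if "code_at P p (compile p (Ite b c d))" for P p
    unfolding steps_add using that False by (simp add: step_jump step_Jump d add_ac)
  moreover have "Q (1 + (t + 1)) R' X'"
    using Q by simp
  ultimately show ?thesis
    unfolding wp_def by blast
qed

lemma wp_While_False:
  assumes "\<not> holds b R X" "Q 2 R X"
  shows "wp w D (While b c) Q R X"
proof -
  have "steps w P 2 (machine_state D p R X) =
      Some (machine_state D (p + code_length (While b c)) R X)"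
    if "code_at P p (compile p (While b c))" for P p
    using that assms(1) by (simp add: numeral_2_eq_2 step_jump step_Jump add_ac)
  with assms(2) show ?thesis
    unfolding wp_def by blast
qed

lemma wp_While_True:
  assumes "holds b R X"
    and "wp w D c (\<lambda>t R X. wp w D (While b c) (\<lambda>t'. Q (t + 2 + t')) R X) R X"
  shows "wp w D (While b c) Q R X"
proof -
  from assms(2) obtain t1 R1 X1 where d: "wp w D (While b c) (\<lambda>t'. Q (t1 + 2 + t')) R1 X1" and c:
    "\<And>P p. code_at P p (compile p c) \<Longrightarrow>
      steps w P t1 (machine_state D p R X) = Some (machine_state D (p + code_length c) R1 X1)"
    by (rule wpE) blast
  from d obtain t2 R2 X2 where Q: "Q (t1 + 2 + t2) R2 X2" and d:
    "\<And>P p. code_at P p (compile p (While b c)) \<Longrightarrow>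
      steps w P t2 (machine_state D p R1 X1) =
        Some (machine_state D (p + code_length (While b c)) R2 X2)"
    by (rule wpE) blast
  have "steps w P (1 + (t1 + (1 + t2))) (machine_state D p R X) =
      Some (machine_state D (p + code_length (While b c)) R2 X2)"
    if code: "code_at P p (compile p (While b c))" for P p
  proof -
    have "steps w P 1 (machine_state D p R X) = Some (machine_state D (p + 2) R X)"
      using code assms(1) by (simp add: step_jump)
    moreover have "steps w P t1 (machine_state D (p + 2) R X) =
        Some (machine_state D (p + 2 + code_length c) R1 X1)"
      using code by (intro c) simp
    moreover have "steps w P 1 (machine_state D (p + 2 + code_length c) R1 X1) =
        Some (machine_state D p R1 X1)"
      using code by (simp add: step_Jump add_ac)
    ultimately show ?thesis
      unfolding steps_add using d[OF code] by simp
  qed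
  moreover have "Q (1 + (t1 + (1 + t2))) R2 X2"
    using Q by (simp add: add_ac)
  ultimately show ?thesis
    unfolding wp_def by blast
qed

text \<open>The loop variant \<open>n\<close> is the number of steps still allowed.\<close>

lemma wp_While:
  assumes "I n R X"
    and "\<And>n R X. I n R X \<Longrightarrow> holds b R X \<Longrightarrow>
      wp w D c (\<lambda>t R' X'. \<exists>n'. n' + t + 2 \<le> n \<and> I n' R' X') R X"
    and "\<And>n R X. I n R X \<Longrightarrow> \<not> holds b R X \<Longrightarrow> 2 \<le> n \<and> Q R X"
  shows "wp w D (While b c) (\<lambda>t R' X'. t \<le> n \<and> Q R' X') R X"
  using assms(1)
proof (induction n arbitrary: R X rule: less_induct)
  case (less n)
  show ?case
  proof (cases "holds b R X")
    case True
    show ?thesis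
    proof (rule wp_While_True[OF True], rule wp_mono[OF assms(2)[OF less.prems True]])
      fix t R' X'
      assume "\<exists>n'. n' + t + 2 \<le> n \<and> I n' R' X'"
      then obtain n' where n': "n' + t + 2 \<le> n" "I n' R' X'"
        by blast
      show "wp w D (While b c) (\<lambda>t' R' X'. t + 2 + t' \<le> n \<and> Q R' X') R' X'"
        by (rule wp_mono[OF less.IH[OF _ n'(2)]]) (use n'(1) in auto)
    qed
  next
    case False
    with assms(3)[OF less.prems False] show ?thesis
      by (intro wp_While_False) auto
  qed
qed

text \<open>The image is constant in \<open>machine_state\<close>, so the demand that memory be
  restored holds at once; the appended \<open>Halt\<close> sits exactly where the compiled code
  ends.\<close>

lemma wp_answers:
  assumes "wp w D c (\<lambda>t R X. real t \<le> T \<and> R 0 = a) (\<lambda>_. 0) ((\<lambda>_. 0)(0 := x1, 1 := x2))"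
  shows "answers w (compile 0 c @ [Halt]) D x1 x2 T a"
proof -
  from assms obtain t R X where t: "real t \<le> T" and a: "R 0 = a" and
    run: "\<And>P p. code_at P p (compile p c) \<Longrightarrow>
      steps w P t (machine_state D p (\<lambda>_. 0) ((\<lambda>_. 0)(0 := x1, 1 := x2))) =
        Some (machine_state D (p + code_length c) R X)"
    by (rule wpE) blast
  have "steps w (compile 0 c @ [Halt]) t (query_state D x1 x2) =
      Some (machine_state D (code_length c) R X)"
    using run[OF code_at_self] by (simp add: machine_state_def query_state_def)
  then show ?thesis
    unfolding answers_def using t a
    by (intro exI[of _ t] exI[of _ "machine_state D (code_length c) R X"])
      (simp add: machine_state_def halted_def nth_append)
qed

section \<open>Wedges in a graph on ranks\<close>

lemma initial_segment_nat:
  fixes S :: "nat set"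
  assumes "finite S" "\<And>i j. i \<in> S \<Longrightarrow> j < i \<Longrightarrow> j \<in> S"
  shows "S = {..<card S}"
proof -
  define k where "k = (LEAST k. k \<notin> S)"
  have "\<exists>k. k \<notin> S"
    using assms(1) infinite_UNIV_nat by (metis ex_new_if_finite)
  then have "k \<notin> S"
    unfolding k_def by (rule LeastI_ex)
  moreover have "i \<in> S" if "i < k" for i
    using that not_less_Least unfolding k_def by blast
  ultimately have "S = {..<k}"
    using assms(2) by (metis lessThan_iff linorder_neqE_nat subsetI subset_antisym)
  then show ?thesis
    by simp
qed

text \<open>Translates between the position at which a binary search stops and the number of indices
  satisfying a downward closed predicate.\<close>

lemma less_card_initial_segment_iff:
  fixes P :: "nat \<Rightarrow> bool"
  assumes "\<And>i j. j < i \<Longrightarrow> i < n \<Longrightarrow> P i \<Longrightarrow> P j" "i < n"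
  shows "P i \<longleftrightarrow> i < card {i. i < n \<and> P i}"
proof -
  have "{i. i < n \<and> P i} = {..<card {i. i < n \<and> P i}}"
    by (rule initial_segment_nat) (use assms(1) in \<open>auto dest: less_trans\<close>)
  with assms(2) show ?thesis
    by blast
qed

text \<open>The key need not belong to the set: this is what a binary search returns for an
  arbitrary key, and differences of ranks count half-open intervals.\<close>

definition rank :: "'a::linorder set \<Rightarrow> 'a \<Rightarrow> nat" where
  "rank A x = card {y \<in> A. y < x}"

lemma rank_le_card: "finite A \<Longrightarrow> rank A x \<le> card A"
  unfolding rank_def by (intro card_mono) auto

lemma rank_mono: "finite A \<Longrightarrow> x \<le> y \<Longrightarrow> rank A x \<le> rank A y"
  unfolding rank_def by (intro card_mono) auto

lemma rank_add_card:
  assumes "finite A" "x \<le> y"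
  shows "rank A y = rank A x + card {z \<in> A. x \<le> z \<and> z < y}"
proof -
  have "card ({z \<in> A. z < x} \<union> {z \<in> A. x \<le> z \<and> z < y}) =
      card {z \<in> A. z < x} + card {z \<in> A. x \<le> z \<and> z < y}"
    using assms(1) by (intro card_Un_disjoint) auto
  moreover have "{z \<in> A. z < x} \<union> {z \<in> A. x \<le> z \<and> z < y} = {z \<in> A. z < y}"
    using assms(2) by auto
  ultimately show ?thesis
    unfolding rank_def by simp
qed

lemma nth_sorted_list_less_iff:
  assumes "finite A" "i < card A"
  shows "sorted_list_of_set A ! i < x \<longleftrightarrow> i < rank A x"
proof -
  let ?xs = "sorted_list_of_set A"
  have sorted: "sorted_wrt (<) ?xs"
    by simp
  have "bij_betw ((!) ?xs) {i. i < card A \<and> ?xs ! i < x} {y \<in> A. y < x}"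
  proof (rule bij_betw_imageI)
    show "inj_on ((!) ?xs) {i. i < card A \<and> ?xs ! i < x}"
      using assms(1) by (auto simp: inj_on_def nth_eq_iff_index_eq)
    have "(!) ?xs ` {i. i < card A} = A"
      using assms(1) set_conv_nth[of ?xs] by auto
    then have "y \<in> A \<longleftrightarrow> (\<exists>i<card A. y = ?xs ! i)" for y
      by (auto simp: set_eq_iff image_iff)
    then show "(!) ?xs ` {i. i < card A \<and> ?xs ! i < x} = {y \<in> A. y < x}"
      by (auto simp: image_iff)
  qed
  then have "rank A x = card {i. i < card A \<and> ?xs ! i < x}"
    unfolding rank_def by (metis bij_betw_same_card)
  moreover have "?xs ! j < x" if "j < i" "i < card A" "?xs ! i < x" for i j
    using sorted_wrt_nth_less[OF sorted, of j i] that by simp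
  ultimately show ?thesis
    using less_card_initial_segment_iff[of "card A" "\<lambda>i. ?xs ! i < x" i] assms(2) by simp
qed

lemma bij_betw_nth_rank:
  assumes "finite A"
  shows "bij_betw ((!) (sorted_list_of_set A)) {rank A x..<rank A y} {z \<in> A. x \<le> z \<and> z < y}"
proof (rule bij_betw_imageI)
  let ?xs = "sorted_list_of_set A"
  have le: "rank A z \<le> card A" for z
    by (rule rank_le_card[OF assms])
  have A: "(!) ?xs ` {i. i < card A} = A"
    using assms set_conv_nth[of ?xs] by auto
  show "inj_on ((!) ?xs) {rank A x..<rank A y}"
    using assms le[of y] by (auto simp: inj_on_def nth_eq_iff_index_eq)
  have less: "?xs ! i < z \<longleftrightarrow> i < rank A z" if "i < card A" for i z
    by (rule nth_sorted_list_less_iff[OF assms that])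
  show "(!) ?xs ` {rank A x..<rank A y} = {z \<in> A. x \<le> z \<and> z < y}"
  proof (intro equalityI subsetI)
    fix z
    assume "z \<in> (!) ?xs ` {rank A x..<rank A y}"
    then obtain i where i: "z = ?xs ! i" "rank A x \<le> i" "i < rank A y"
      by auto
    then have "i < card A"
      using le[of y] by simp
    then have "z \<in> A"
      using A i(1) by blast
    with i less[OF \<open>i < card A\<close>, of x] less[OF \<open>i < card A\<close>, of y]
    show "z \<in> {z \<in> A. x \<le> z \<and> z < y}"
      by auto
  next
    fix z
    assume z: "z \<in> {z \<in> A. x \<le> z \<and> z < y}"
    then obtain i where i: "z = ?xs ! i" "i < card A"
      using A by blast
    with z less[OF i(2), of x] less[OF i(2), of y]
    show "z \<in> (!) ?xs ` {rank A x..<rank A y}"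
      by auto
  qed
qed

section \<open>Wedge counts and sorted incidences\<close>

locale rank_graph =
  fixes N :: nat and adj :: "nat \<Rightarrow> nat \<Rightarrow> bool"
  assumes adj_sym: "adj u v \<Longrightarrow> adj v u"
    and adj_irrefl: "\<not> adj u u"
    and adj_less: "adj u v \<Longrightarrow> u < N"
    and adj_ex: "u < N \<Longrightarrow> \<exists>v. adj u v"
begin

definition deg_in :: "nat set \<Rightarrow> nat \<Rightarrow> nat" where
  "deg_in S u = card {v \<in> S. adj u v}"

definition wedges :: "nat set \<Rightarrow> nat" where
  "wedges S = (\<Sum>u\<in>S. deg_in S u choose 2)"

lemma wedges_empty [simp]: "wedges {} = 0"
  by (simp add: wedges_def)

lemma deg_in_insert:
  assumes "finite S" "u \<notin> S"
  shows "deg_in (insert u S) v = deg_in S v + (if adj v u then 1 else 0)"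
proof -
  have "{x \<in> insert u S. adj v x} =
      (if adj v u then insert u {x \<in> S. adj v x} else {x \<in> S. adj v x})"
    by auto
  with assms show ?thesis
    unfolding deg_in_def by simp
qed

text \<open>Wedges are counted by centre. The degree of each neighbour of \<open>u\<close> rises
  from \<open>d\<close> to \<open>Suc d\<close>, and
  \<open>Suc d choose 2 = (d choose 2) + d\<close>; no other degree in \<open>S\<close>
  changes.\<close>

lemma wedges_insert:
  assumes "finite S" "u \<notin> S"
  shows "wedges (insert u S) =
    wedges S + (deg_in S u choose 2) + (\<Sum>v\<in>{v \<in> S. adj u v}. deg_in S v)"
proof -
  have "(deg_in (insert u S) v choose 2) =
      (deg_in S v choose 2) + (if adj u v then deg_in S v else 0)" for v
    using adj_sym[of u v] adj_sym[of v u] by (auto simp: deg_in_insert[OF assms] numeral_2_eq_2)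
  then have "(\<Sum>v\<in>S. deg_in (insert u S) v choose 2) =
      wedges S + (\<Sum>v\<in>S. if adj u v then deg_in S v else 0)"
    by (simp add: wedges_def sum.distrib)
  also have "(\<Sum>v\<in>S. if adj u v then deg_in S v else 0) = (\<Sum>v\<in>{v \<in> S. adj u v}. deg_in S v)"
    using assms(1) by (rule sum.inter_filter[symmetric])
  finally show ?thesis
    using assms by (simp add: wedges_def[of "insert u S"] deg_in_insert adj_irrefl)
qed

text \<open>A crude cubic bound, used to show that every count fits into one machine word.\<close>

lemma wedges_le:
  assumes "S \<subseteq> {..<N}"
  shows "wedges S \<le> N * N * N"
proof -
  have "finite S"
    using assms finite_subset by blast
  have card: "card S \<le> N"
    using card_mono[OF _ assms] by simp
  have "deg_in S u choose 2 \<le> N * N" for u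
  proof -
    have "deg_in S u \<le> N"
      unfolding deg_in_def using card card_mono[OF \<open>finite S\<close>, of "{v \<in> S. adj u v}"] by force
    then have "deg_in S u * (deg_in S u - 1) \<le> N * N"
      by (intro mult_mono) auto
    then show ?thesis
      unfolding choose_two using div_le_dividend le_trans by blast
  qed
  then have "wedges S \<le> card S * (N * N)"
    unfolding wedges_def using sum_bounded_above[of S "\<lambda>u. deg_in S u choose 2" "N * N"] by simp
  also have "\<dots> \<le> N * (N * N)"
    using card by (rule mult_right_mono) simp
  finally show ?thesis
    by (simp add: mult.assoc)
qed

text \<open>
  Sorting the codes \<open>u * N + v\<close> concatenates the sorted adjacency lists, so a single rank
  query in this set replaces a search within one adjacency list.
\<close>

definition codes :: "nat set" where
  "codes = {u * N + v |u v. adj u v}"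

lemma adj_less': "adj u v \<Longrightarrow> v < N"
  by (rule adj_less[OF adj_sym])

lemma finite_adj: "finite {(u, v). adj u v}"
  by (rule finite_subset[of _ "{..<N} \<times> {..<N}"]) (auto dest: adj_less adj_less')

lemma codes_eq: "codes = (\<lambda>(u, v). u * N + v) ` {(u, v). adj u v}"
  unfolding codes_def by auto

lemma finite_codes [simp]: "finite codes"
  unfolding codes_eq using finite_adj by simp

lemma code_eq_iff:
  assumes "v < N" "v' < N"
  shows "u * N + v = u' * N + v' \<longleftrightarrow> u = u' \<and> v = v'"
proof
  assume eq: "u * N + v = u' * N + v'"
  from arg_cong[OF eq, of "\<lambda>x. x div N"] arg_cong[OF eq, of "\<lambda>x. x mod N"] assms
  show "u = u' \<and> v = v'"
    by simp
qed auto

lemma card_codes: "card codes = card {(u, v). adj u v}"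
  unfolding codes_eq by (intro card_image) (auto simp: inj_on_def code_eq_iff adj_less')

lemma codes_less: "e \<in> codes \<Longrightarrow> e < N * N"
proof -
  assume "e \<in> codes"
  then obtain u v where "e = u * N + v" "adj u v"
    unfolding codes_def by auto
  then have "e = u * N + v" "Suc u \<le> N" "v < N"
    using adj_less[of u v] adj_less'[of u v] by auto
  moreover have "Suc u * N \<le> N * N"
    using \<open>Suc u \<le> N\<close> by (rule mult_right_mono) simp
  ultimately show "e < N * N"
    by simp
qed

text \<open>The case \<open>hi = N\<close> is included: the upper key is then the least possible
  code of the next vertex, so the interval still ends with the list of \<open>u\<close>.\<close>

lemma codes_between:
  assumes "hi \<le> N"
  shows "{e \<in> codes. u * N + lo \<le> e \<and> e < u * N + hi} = (\<lambda>v. u * N + v) ` {v \<in> {lo..<hi}. adj u v}"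
proof (intro equalityI subsetI)
  fix e
  assume "e \<in> {e \<in> codes. u * N + lo \<le> e \<and> e < u * N + hi}"
  then obtain u' v where e: "e = u' * N + v" "adj u' v" "u * N + lo \<le> e" "e < u * N + hi"
    unfolding codes_def by auto
  define x where "x = e - u * N"
  have "e = u * N + x" "x < N" "lo \<le> x" "x < hi"
    using e assms unfolding x_def by auto
  moreover from this e have "u' = u \<and> v = x"
    using code_eq_iff[of v x u' u] adj_less'[of u' v] by metis
  ultimately show "e \<in> (\<lambda>v. u * N + v) ` {v \<in> {lo..<hi}. adj u v}"
    using e(2) by auto
qed (auto simp: codes_def)

lemma rank_codes:
  assumes "lo \<le> hi" "hi \<le> N"
  shows "rank codes (u * N + hi) = rank codes (u * N + lo) + deg_in {lo..<hi} u"
proof -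
  have "card ((\<lambda>v. u * N + v) ` {v \<in> {lo..<hi}. adj u v}) = deg_in {lo..<hi} u"
    unfolding deg_in_def by (intro card_image) (auto simp: inj_on_def)
  then show ?thesis
    using assms rank_add_card[of codes "u * N + lo" "u * N + hi"] codes_between[of hi u lo] by simp
qed

text \<open>Justifies enumerating the neighbours within a range by scanning consecutive positions
  between two ranks; no separate adjacency pointers are stored.\<close>

lemma bij_betw_neighbours:
  assumes "hi \<le> N"
  shows "bij_betw (\<lambda>i. sorted_list_of_set codes ! i - u * N)
    {rank codes (u * N + lo)..<rank codes (u * N + hi)} {v \<in> {lo..<hi}. adj u v}"
proof -
  have "bij_betw (\<lambda>e. e - u * N) ((\<lambda>v. u * N + v) ` {v \<in> {lo..<hi}. adj u v})
      {v \<in> {lo..<hi}. adj u v}"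
    by (intro bij_betw_byWitness[where f' = "\<lambda>v. u * N + v"]) auto
  from bij_betw_trans[OF bij_betw_nth_rank[OF finite_codes] this[folded codes_between[OF assms]]]
  show ?thesis
    by (simp add: comp_def)
qed

section \<open>Blocks of incidences and their boundaries\<close>

definition degree :: "nat \<Rightarrow> nat" where
  "degree u = deg_in {..<N} u"

text \<open>The prefix sum of the degrees, by \<open>offset_Suc\<close>: the position at which the
  list of \<open>u\<close> starts in the concatenation.\<close>

definition offset :: "nat \<Rightarrow> nat" where
  "offset u = rank codes (u * N)"

text \<open>This is where the absence of isolated vertices enters; it lets a fixed cost per vertex
  be charged to its degree.\<close>

lemma degree_pos: "u < N \<Longrightarrow> 0 < degree u"
proof -
  assume "u < N"
  then obtain v where "adj u v"
    using adj_ex by blast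
  then have "v \<in> {v \<in> {..<N}. adj u v}"
    using adj_less' by simp
  then show ?thesis
    unfolding degree_def deg_in_def by (auto simp: card_gt_0_iff)
qed

lemma deg_in_le_degree: "hi \<le> N \<Longrightarrow> deg_in {lo..<hi} u \<le> degree u"
  unfolding deg_in_def degree_def by (intro card_mono) auto

lemma offset_Suc: "offset (Suc u) = offset u + degree u"
  using rank_codes[of 0 N u] by (simp add: offset_def degree_def add.commute atLeast0LessThan)

lemma offset_mono: "u \<le> v \<Longrightarrow> offset u \<le> offset v"
  unfolding offset_def by (intro rank_mono) auto

lemma offset_le: "offset u \<le> card codes"
  unfolding offset_def by (rule rank_le_card) simp

text \<open>For positive \<open>l\<close>, a list that ends exactly at a multiple of
  \<open>l\<close> counts as crossing, one that merely starts there does not.\<close>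

definition crossing :: "nat \<Rightarrow> nat set" where
  "crossing l = {v. v < N \<and> offset v div l < offset (Suc v) div l}"

text \<open>The extreme values \<open>0\<close> and \<open>N\<close> guarantee a boundary on either
  side of every position, so that the searches for the nearest boundaries always succeed.\<close>

definition boundaries :: "nat \<Rightarrow> nat set" where
  "boundaries l = {0, N} \<union> crossing l \<union> Suc ` crossing l"

lemma finite_crossing [simp]: "finite (crossing l)"
  unfolding crossing_def by simp

lemma finite_boundaries [simp]: "finite (boundaries l)"
  unfolding boundaries_def by simp

lemma boundaries_le: "v \<in> boundaries l \<Longrightarrow> v \<le> N"
  unfolding boundaries_def crossing_def by auto

text \<open>Block numbers never decrease along the offsets and increase strictly at each crossing
  vertex, so mapping such a vertex to the block reached at its end is injective, with values from 1
  to \<open>card codes div l\<close>.\<close>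

lemma card_crossing: "card (crossing l) \<le> card codes div l"
proof -
  have inj: "inj_on (\<lambda>v. offset (Suc v) div l) (crossing l)"
  proof (rule linorder_inj_onI)
    fix u v
    assume "u < v" "v \<in> crossing l"
    then have "offset (Suc u) div l \<le> offset v div l"
      by (intro div_le_mono offset_mono) simp
    also have "\<dots> < offset (Suc v) div l"
      using \<open>v \<in> crossing l\<close> by (simp add: crossing_def)
    finally show "offset (Suc u) div l \<noteq> offset (Suc v) div l"
      by simp
  qed auto
  have "(\<lambda>v. offset (Suc v) div l) ` crossing l \<subseteq> {1..card codes div l}"
    using div_le_mono[OF offset_le] by (auto simp: crossing_def)
  from card_mono[OF _ this] show ?thesis
    by (simp add: card_image[OF inj])
qed

lemma card_boundaries: "card (boundaries l) \<le> 2 + 2 * (card codes div l)"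
proof -
  have "card (boundaries l) \<le> card {0, N} + card (crossing l) + card (Suc ` crossing l)"
    unfolding boundaries_def by (meson card_Un_le add_le_mono le_trans order_refl)
  also have "\<dots> \<le> 2 + card (crossing l) + card (crossing l)"
    by (intro add_mono card_image_le) (auto simp: card_insert_if)
  finally show ?thesis
    using card_crossing[of l] by linarith
qed

lemma card_boundaries_le: "card (boundaries l) \<le> N + 1"
proof -
  have "boundaries l \<subseteq> {..N}"
    using boundaries_le by auto
  from card_mono[OF _ this] show ?thesis
    by simp
qed

text \<open>A run of vertices without a crossing lies in one block of \<open>l\<close> codes.\<close>

lemma offset_diff_less:
  assumes "0 < l" "a \<le> b" "b \<le> N" "\<And>v. a \<le> v \<Longrightarrow> v < b \<Longrightarrow> v \<notin> crossing l"
  shows "offset b - offset a < l"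
proof -
  have "offset b div l = offset a div l"
    using assms(2-4)
  proof (induction b rule: dec_induct)
    case (step v)
    then have "v \<notin> crossing l"
      by simp
    with step have "offset (Suc v) div l \<le> offset v div l"
      by (simp add: crossing_def)
    moreover have "offset v div l \<le> offset (Suc v) div l"
      by (intro div_le_mono offset_mono) simp
    ultimately show ?case
      using step by simp
  qed simp
  then have "offset b < offset a div l * l + l"
    using dividend_less_div_times[OF assms(1), of "offset b"] by simp
  moreover have "offset a div l * l \<le> offset a"
    by simp
  ultimately show ?thesis
    using assms(1) by linarith
qed

end

section \<open>Binary search\<close>

lemmas wp_intros = wp_Seq wp_Const wp_Move wp_Add wp_Sub wp_Mul wp_Div wp_Load wp_RLoad

definition bsearch :: "com \<Rightarrow> com" where
  "bsearch c = Do (Const 4 0) ;; While (Less 4 5) (Do (Add 7 4 5) ;; Do (Div 7 7 22) ;; c)"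

text \<open>The comparison is a parameter \<open>c\<close> of cost at most \<open>k\<close>, so that
  word keys and real keys share one proof. A round costs \<open>k + 4\<close>: two instructions for
  the midpoint and two for the loop; the remaining 3 steps are the initialisation and the exit. The
  bound on \<open>2 * n\<close> keeps the sum of the two ends from overflowing.\<close>

lemma wp_bsearch:
  fixes R :: "nat \<Rightarrow> nat" and X :: "nat \<Rightarrow> real" and P :: "nat \<Rightarrow> bool"
  assumes len: "R 5 = n" "n < 2 ^ j" "2 * n < 2 ^ w" and two: "R 22 = 2"
    and P: "\<And>i i'. i' < i \<Longrightarrow> i < n \<Longrightarrow> P i \<Longrightarrow> P i'"
    and c: "\<And>R' X'. \<forall>r. r \<notin> {4, 5, 7, 8} \<longrightarrow> R' r = R r \<Longrightarrow> \<forall>r. r \<noteq> 2 \<longrightarrow> X' r = X r \<Longrightarrow>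
      R' 7 < n \<Longrightarrow>
      wp w D c (\<lambda>t R'' X''. t \<le> k \<and> (\<forall>r. r \<notin> {4, 5, 7, 8} \<longrightarrow> R'' r = R r) \<and>
        (\<forall>r. r \<noteq> 2 \<longrightarrow> X'' r = X r) \<and>
        R'' 4 = (if P (R' 7) then R' 7 + 1 else R' 4) \<and>
        R'' 5 = (if P (R' 7) then R' 5 else R' 7)) R' X'"
    and Q: "\<And>t R' X'. t \<le> j * (k + 4) + 3 \<Longrightarrow> \<forall>r. r \<notin> {4, 5, 7, 8} \<longrightarrow> R' r = R r \<Longrightarrow>
      \<forall>r. r \<noteq> 2 \<longrightarrow> X' r = X r \<Longrightarrow> R' 4 = card {i. i < n \<and> P i} \<Longrightarrow> Q t R' X'"
  shows "wp w D (bsearch c) Q R X"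
proof -
  define m where "m = card {i. i < n \<and> P i}"
  have m: "P i \<longleftrightarrow> i < m" if "i < n" for i
    using less_card_initial_segment_iff[of n P i] P that unfolding m_def by blast
  have "m \<le> n"
    unfolding m_def using card_mono[of "{..<n}" "{i. i < n \<and> P i}"] by auto
  \<comment> \<open>The width of the open interval is below \<open>2 ^ i\<close>. A round discards
    the midpoint and one side, which leaves a width below \<open>2 ^ (i - 1)\<close>.\<close>
  define I where "I = (\<lambda>b R' X'. \<exists>i. b = i * (k + 4) + 2 \<and> R' 5 - R' 4 < (2 :: nat) ^ i \<and>
    R' 4 \<le> m \<and> m \<le> R' 5 \<and> R' 5 \<le> n \<and>
    (\<forall>r. r \<notin> {4, 5, 7, 8} \<longrightarrow> R' r = R r) \<and> (\<forall>r. r \<noteq> 2 \<longrightarrow> X' r = X r))"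
  have start: "I (j * (k + 4) + 2) (R(4 := 0)) X"
    unfolding I_def using len \<open>m \<le> n\<close> by auto
  have loop: "wp w D (Do (Add 7 4 5) ;; Do (Div 7 7 22) ;; c)
      (\<lambda>t R' X'. \<exists>b'. b' + t + 2 \<le> b \<and> I b' R' X') R' X'"
    if I: "I b R' X'" and less: "R' 4 < R' 5" for b R' X'
  proof -
    from I obtain i where b: "b = i * (k + 4) + 2" and i: "R' 5 - R' 4 < 2 ^ i" and
      r: "R' 4 \<le> m" "m \<le> R' 5" "R' 5 \<le> n" and
      frame: "\<forall>r. r \<notin> {4, 5, 7, 8} \<longrightarrow> R' r = R r" "\<forall>r. r \<noteq> 2 \<longrightarrow> X' r = X r"
      unfolding I_def by blast
    obtain i' where i': "i = Suc i'"
      using i less by (cases i) auto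
    define mid where "mid = (R' 4 + R' 5) div 2"
    define R1 where "R1 = R'(7 := R' 4 + R' 5, 7 := mid)"
    have mid: "R' 4 \<le> mid" "mid < R' 5" "R' 5 - (mid + 1) < 2 ^ i'" "mid - R' 4 < 2 ^ i'"
      using i less unfolding mid_def i' by auto
    have "wp w D c (\<lambda>t R'' X''. t \<le> k \<and> (\<forall>r. r \<notin> {4, 5, 7, 8} \<longrightarrow> R'' r = R r) \<and>
        (\<forall>r. r \<noteq> 2 \<longrightarrow> X'' r = X r) \<and>
        R'' 4 = (if P (R1 7) then R1 7 + 1 else R1 4) \<and>
        R'' 5 = (if P (R1 7) then R1 5 else R1 7)) R1 X'"
      by (rule c) (use frame mid r in \<open>auto simp: R1_def\<close>)
    then have body: "wp w D c (\<lambda>t R' X'. \<exists>b'. b' + (1 + (1 + t)) + 2 \<le> b \<and> I b' R' X') R1 X'"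
    proof (rule wp_mono)
      fix t R2 X2
      assume *: "t \<le> k \<and> (\<forall>r. r \<notin> {4, 5, 7, 8} \<longrightarrow> R2 r = R r) \<and>
        (\<forall>r. r \<noteq> 2 \<longrightarrow> X2 r = X r) \<and>
        R2 4 = (if P (R1 7) then R1 7 + 1 else R1 4) \<and>
        R2 5 = (if P (R1 7) then R1 5 else R1 7)"
      have "P mid \<longleftrightarrow> mid < m"
        using m mid r by simp
      then have "I (i' * (k + 4) + 2) R2 X2"
        unfolding I_def using * mid r by (intro exI[of _ i']) (auto simp: R1_def)
      then show "\<exists>b'. b' + (1 + (1 + t)) + 2 \<le> b \<and> I b' R2 X2"
        using * unfolding b i' by (intro exI[of _ "i' * (k + 4) + 2"]) auto
    qed
    have "R' 22 = 2"
      using frame two by simp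
    then have "R1 = R'(7 := R' 4 + R' 5, 7 := (R'(7 := R' 4 + R' 5)) 7 div (R'(7 := R' 4 + R' 5)) 22)"
      unfolding R1_def mid_def by simp
    with body show ?thesis
      using r less len by (intro wp_intros) auto
  qed
  have exit: "2 \<le> b \<and> (R' 4 = m \<and> (\<forall>r. r \<notin> {4, 5, 7, 8} \<longrightarrow> R' r = R r) \<and>
      (\<forall>r. r \<noteq> 2 \<longrightarrow> X' r = X r))" if "I b R' X'" "\<not> R' 4 < R' 5" for b R' X'
    using that unfolding I_def by auto
  have "wp w D (While (Less 4 5) (Do (Add 7 4 5) ;; Do (Div 7 7 22) ;; c))
      (\<lambda>t R' X'. t \<le> j * (k + 4) + 2 \<and> R' 4 = m \<and>
        (\<forall>r. r \<notin> {4, 5, 7, 8} \<longrightarrow> R' r = R r) \<and> (\<forall>r. r \<noteq> 2 \<longrightarrow> X' r = X r)) (R(4 := 0)) X"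
    by (rule wp_While[where I = I, OF start]) (use loop exit in simp_all)
  then have "wp w D (While (Less 4 5) (Do (Add 7 4 5) ;; Do (Div 7 7 22) ;; c))
      (\<lambda>t. Q (1 + t)) (R(4 := 0)) X"
    by (rule wp_mono) (rule Q, auto simp: m_def)
  then show ?thesis
    unfolding bsearch_def by (intro wp_intros) auto
qed

section \<open>The query program\<close>

text \<open>
  Register conventions: 0 the answer; 1, 22, 23 the constants 1, 2, 3; 2 the number of
  vertices; 13 and 19 the numbers of codes and of boundaries; 3 the base address and 6 the key
  of a search, whose array length goes to 5 and whose result to 4; 9, 10 the query range;
  11, 12 the range counted so far.
\<close>

definition word_body :: com where
  "word_body = Do (Add 8 3 7) ;; Do (Load 8 8) ;; Ite (Less 8 6) (Do (Add 4 7 1)) (Do (Move 5 7))"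

definition code_rank :: "nat \<Rightarrow> nat \<Rightarrow> com" where
  "code_rank a b = Do (Add 6 a b) ;; Do (Move 5 13) ;; bsearch word_body"

text \<open>Each degree is added as the upper rank minus the lower rank. In this order the
  subtraction never goes below zero, and the temporary excess in register 0 is at most
  \<open>card codes\<close>.\<close>

definition sum_neighbours :: com where
  "sum_neighbours = While (Less 16 17)
    (Do (Add 8 3 16) ;; Do (Load 8 8) ;; Do (Sub 8 8 14) ;; Do (Mul 18 8 2) ;;
     code_rank 18 12 ;; Do (Add 0 0 4) ;; code_rank 18 11 ;; Do (Sub 0 0 4) ;; Do (Add 16 16 1))"

definition add_vertex :: com where
  "add_vertex = Do (Mul 14 15 2) ;;
    code_rank 14 11 ;; Do (Move 16 4) ;; code_rank 14 12 ;; Do (Move 17 4) ;;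
    Do (Sub 8 17 16) ;; Do (Mul 7 8 8) ;; Do (Sub 7 7 8) ;; Do (Div 7 7 22) ;; Do (Add 0 0 7) ;;
    sum_neighbours"

definition absorb :: com where
  "absorb = add_vertex ;; Do (Move 11 27) ;; Do (Move 12 28) ;; Do (Sub 26 12 11)"

text \<open>Registers 25 and 26 hold the lengths of the query range and of the counted range. As the
  latter is contained in the former, equal lengths mean equal ranges, so one comparison controls
  growth at both ends. Registers 27 and 28 hold the next range while \<open>add_vertex\<close> still
  needs the old one.\<close>

definition extend :: com where
  "extend = While (Less 26 25)
    (Ite (Less 9 11)
      (Do (Sub 15 11 1) ;; Do (Move 27 15) ;; Do (Move 28 12))
      (Do (Move 15 12) ;; Do (Move 27 11) ;; Do (Add 28 12 1)) ;;
     absorb)"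

definition lower_real_body :: com where
  "lower_real_body = Do (RLoad 2 7) ;; Ite (RLess 2 0) (Do (Add 4 7 1)) (Do (Move 5 7))"

text \<open>Real comparisons are strict, so the non-strict test against the right endpoint is
  obtained by exchanging the branches.\<close>

definition upper_real_body :: com where
  "upper_real_body = Do (RLoad 2 7) ;; Ite (RLess 1 2) (Do (Move 5 7)) (Do (Add 4 7 1))"

text \<open>Cells 0, 1 and 2 are addressed through registers 0, 1 and 22, the first of which is
  still zero at the start.\<close>

definition load_header :: com where
  "load_header = Do (Const 1 1) ;; Do (Const 22 2) ;; Do (Const 23 3) ;;
    Do (Load 2 0) ;; Do (Load 13 1) ;; Do (Load 19 22)"

definition find_range :: com where
  "find_range = Do (Move 5 2) ;; bsearch lower_real_body ;; Do (Move 9 4) ;;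
    Do (Move 5 2) ;; bsearch upper_real_body ;; Do (Move 10 4)"

text \<open>Searching for \<open>b + 1\<close> counts the boundaries up to and including
  \<open>b\<close>; one less is the index of the last of them.\<close>

definition find_blocks :: com where
  "find_blocks = Do (Add 20 23 13) ;; Do (Move 3 20) ;;
    Do (Move 5 19) ;; Do (Move 6 9) ;; bsearch word_body ;; Do (Move 21 4) ;;
    Do (Move 5 19) ;; Do (Add 6 10 1) ;; bsearch word_body ;; Do (Sub 24 4 1) ;;
    Do (Add 8 20 21) ;; Do (Load 11 8) ;; Do (Add 8 20 24) ;; Do (Load 12 8)"

text \<open>If the last boundary up to \<open>b\<close> precedes the first one from \<open>a\<close>
  on, no tabulated range lies inside the query; the count then starts from the empty range at
  \<open>a\<close>, with register 0 still zero.\<close>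

definition start_count :: com where
  "start_count = Ite (Less 12 11)
      (Do (Move 11 9) ;; Do (Move 12 9))
      (Do (Mul 8 21 19) ;; Do (Add 8 8 24) ;; Do (Add 8 8 20) ;; Do (Add 8 8 19) ;; Do (Load 0 8)) ;;
    Do (Move 3 23) ;; Do (Sub 25 10 9) ;; Do (Sub 26 12 11)"

definition query_code :: com where
  "query_code = load_header ;; find_range ;; find_blocks ;; start_count ;; extend"

text \<open>The assumption \<open>words\<close> adds up all magnitudes that occur, so that each
  overflow condition follows by linear arithmetic; \<open>log\<close> gives one bound
  \<open>j\<close> on the rounds of every search.\<close>

locale rank_structure = rank_graph +
  fixes w j l :: nat and vals :: "real list"
  assumes length_vals: "length vals = N"
    and sorted_vals: "sorted vals"
    and l_pos: "0 < l"
    and words: "N * N * N + N * N + N + 2 * card codes + 2 * card (boundaries l) +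
      card (boundaries l) * card (boundaries l) + 10 < 2 ^ w"
    and log: "card codes + card (boundaries l) + N < 2 ^ j"
begin

section \<open>Layout of the memory image and searches in it\<close>

abbreviation "L \<equiv> card codes"
abbreviation "K \<equiv> card (boundaries l)"
abbreviation "code_list \<equiv> sorted_list_of_set codes"
abbreviation "boundary_list \<equiv> sorted_list_of_set (boundaries l)"

text \<open>The full square is stored, including decreasing pairs with their empty ranges, so that
  the cell of a pair is simply \<open>i * K + i'\<close>.\<close>

definition table :: "nat list" where
  "table = map (\<lambda>i. wedges {boundary_list ! (i div K)..<boundary_list ! (i mod K)}) [0..<K * K]"

definition words_image :: "nat list" where
  "words_image = [N, L, K] @ code_list @ boundary_list @ table"

definition structure_image :: image where
  "structure_image = (words_image, vals)"

lemma fst_image [simp]: "fst structure_image = words_image"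
  and snd_image [simp]: "snd structure_image = vals"
  by (simp_all add: structure_image_def)

lemma length_table [simp]: "length table = K * K"
  by (simp add: table_def)

lemma length_words_image: "length words_image = 3 + L + K + K * K"
  by (simp add: words_image_def)

lemma image_header:
  "words_image ! 0 = N" "words_image ! Suc 0 = L" "words_image ! 2 = K"
  by (simp_all add: words_image_def numeral_2_eq_2)

lemma image_code: "i < L \<Longrightarrow> words_image ! (3 + i) = code_list ! i"
  by (simp add: words_image_def nth_append numeral_3_eq_3)

lemma image_boundary: "i < K \<Longrightarrow> words_image ! (3 + L + i) = boundary_list ! i"
  by (simp add: words_image_def nth_append numeral_3_eq_3)

lemma image_table:
  assumes "i < K" "i' < K"
  shows "words_image ! (3 + L + K + (i * K + i')) = wedges {boundary_list ! i..<boundary_list ! i'}"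
proof -
  have "Suc i * K \<le> K * K"
    using assms(1) by (intro mult_right_mono) auto
  then have "i * K + i' < K * K"
    using assms(2) by simp
  moreover have "(i * K + i') div K = i"
    by (rule div_nat_eqI) (use assms in \<open>auto simp: mult.commute\<close>)
  ultimately show ?thesis
    using assms
    by (simp add: words_image_def nth_append numeral_3_eq_3 table_def)
qed

lemma words_image_less: "x \<in> set words_image \<Longrightarrow> x < 2 ^ w"
proof -
  assume x: "x \<in> set words_image"
  have boundary: "boundary_list ! i \<le> N" if "i < K" for i
    using that boundaries_le nth_mem[of i boundary_list] by simp
  have "wedges {boundary_list ! (i div K)..<boundary_list ! (i mod K)} \<le> N * N * N"
    if "i < K * K" for i
  proof (rule wedges_le)
    have "0 < K"
      using that by (cases K) auto
    then have "boundary_list ! (i mod K) \<le> N"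
      by (intro boundary) simp
    then show "{boundary_list ! (i div K)..<boundary_list ! (i mod K)} \<subseteq> {..<N}"
      by auto
  qed
  with x have "x \<le> N + L + K + N * N + N * N * N"
    unfolding words_image_def table_def
    by (auto dest: codes_less boundaries_le intro: less_imp_le trans_le_add1 trans_le_add2)
  then show ?thesis
    using words by linarith
qed

lemma wp_word_body:
  fixes A :: "nat set"
  assumes A: "finite A" "\<And>i. i < card A \<Longrightarrow> words_image ! (R 3 + i) = sorted_list_of_set A ! i"
    and bound: "R 3 + card A \<le> length words_image"
    and one: "R 1 = 1"
    and frame: "\<forall>r. r \<notin> {4, 5, 7, 8} \<longrightarrow> R' r = R r" "\<forall>r. r \<noteq> 2 \<longrightarrow> X' r = X r"
    and less: "R' 7 < card A"
  shows "wp w structure_image word_body (\<lambda>t R'' X''. t \<le> 5 \<and>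
    (\<forall>r. r \<notin> {4, 5, 7, 8} \<longrightarrow> R'' r = R r) \<and> (\<forall>r. r \<noteq> 2 \<longrightarrow> X'' r = X r) \<and>
    R'' 4 = (if sorted_list_of_set A ! R' 7 < R 6 then R' 7 + 1 else R' 4) \<and>
    R'' 5 = (if sorted_list_of_set A ! R' 7 < R 6 then R' 5 else R' 7)) R' X'"
proof -
  have "length words_image < 2 ^ w"
    using words by (simp add: length_words_image)
  then show ?thesis
    using assms unfolding word_body_def
    by (intro wp_intros wp_Ite) auto
qed

text \<open>Serves both sorted word arrays of the image: \<open>A\<close> is instantiated by
  \<open>codes\<close> and by \<open>boundaries l\<close>.\<close>

lemma wp_word_search:
  fixes A :: "nat set"
  assumes A: "finite A" "\<And>i. i < card A \<Longrightarrow> words_image ! (R 3 + i) = sorted_list_of_set A ! i"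
    and bound: "R 3 + card A \<le> length words_image" "2 * card A < 2 ^ w" "card A < 2 ^ j"
    and regs: "R 1 = 1" "R 22 = 2" "R 5 = card A"
    and Q: "\<And>t R' X'. t \<le> 9 * j + 3 \<Longrightarrow> \<forall>r. r \<notin> {4, 5, 7, 8} \<longrightarrow> R' r = R r \<Longrightarrow>
      R' 4 = rank A (R 6) \<Longrightarrow> Q t R' X'"
  shows "wp w structure_image (bsearch word_body) Q R X"
proof (rule wp_bsearch[where P = "\<lambda>i. sorted_list_of_set A ! i < R 6", OF regs(3) bound(3,2) regs(2)])
  show "sorted_list_of_set A ! i' < R 6"
    if "i' < i" "i < card A" "sorted_list_of_set A ! i < R 6" for i i'
    using that nth_sorted_list_less_iff[OF A(1)] by (metis less_trans)
next
  fix R' X'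
  assume "\<forall>r. r \<notin> {4, 5, 7, 8} \<longrightarrow> R' r = R r" "\<forall>r. r \<noteq> 2 \<longrightarrow> X' r = X r" "R' 7 < card A"
  then show "wp w structure_image word_body (\<lambda>t R'' X''. t \<le> 5 \<and>
      (\<forall>r. r \<notin> {4, 5, 7, 8} \<longrightarrow> R'' r = R r) \<and> (\<forall>r. r \<noteq> 2 \<longrightarrow> X'' r = X r) \<and>
      R'' 4 = (if sorted_list_of_set A ! R' 7 < R 6 then R' 7 + 1 else R' 4) \<and>
      R'' 5 = (if sorted_list_of_set A ! R' 7 < R 6 then R' 5 else R' 7)) R' X'"
    using A bound(1) regs(1) by (intro wp_word_body) auto
next
  fix t R' X'
  assume *: "t \<le> j * (5 + 4) + 3" "\<forall>r. r \<notin> {4, 5, 7, 8} \<longrightarrow> R' r = R r"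
    "R' 4 = card {i. i < card A \<and> sorted_list_of_set A ! i < R 6}"
  have "{i. i < card A \<and> sorted_list_of_set A ! i < R 6} = {..<rank A (R 6)}"
    using nth_sorted_list_less_iff[OF A(1)] rank_le_card[OF A(1), of "R 6"] by fastforce
  with * show "Q t R' X'"
    by (intro Q) simp_all
qed

definition constants_loaded :: "(nat \<Rightarrow> nat) \<Rightarrow> bool" where
  "constants_loaded R \<longleftrightarrow> R 1 = 1 \<and> R 2 = N \<and> R 13 = L \<and> R 19 = K \<and> R 22 = 2 \<and> R 23 = 3"

lemma wp_code_rank:
  assumes "constants_loaded R" "R 3 = 3" "a \<notin> {4..8}" "b \<notin> {4..8}" "R a + R b < 2 ^ w"
    and Q: "\<And>t R' X'. t \<le> 9 * j + 5 \<Longrightarrow> \<forall>r. r \<notin> {4..8} \<longrightarrow> R' r = R r \<Longrightarrow>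
      R' 4 = rank codes (R a + R b) \<Longrightarrow> Q t R' X'"
  shows "wp w structure_image (code_rank a b) Q R X"
  unfolding code_rank_def
  using assms(1-5) words log
proof (intro wp_intros wp_word_search[where A = codes])
qed (auto simp: constants_loaded_def image_code length_words_image intro!: Q)

text \<open>The last summand of \<open>wedges_insert\<close>: new wedges whose centre is a neighbour
  of the added vertex.\<close>

definition nbr_sum :: "nat \<Rightarrow> nat set \<Rightarrow> nat" where
  "nbr_sum u S = (\<Sum>v\<in>{v \<in> S. adj u v}. deg_in S v)"

lemma codes_bound: "L \<le> N * N"
proof -
  have "codes \<subseteq> {..<N * N}"
    using codes_less by auto
  from card_mono[OF _ this] show ?thesis
    by simp
qed

lemma code_bound:
  assumes "u < N" "v \<le> N"
  shows "u * N + v \<le> N * N"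
proof -
  have "Suc u * N \<le> N * N"
    using assms(1) by (intro mult_right_mono) auto
  with assms(2) show ?thesis
    by simp
qed

section \<open>Cost and correctness of adding one vertex\<close>

text \<open>Each neighbour costs two rank searches of \<open>9 * j + 5\<close> steps, seven further
  instructions and two steps of loop control, in total \<open>18 * j + 19\<close>.\<close>

lemma wp_sum_neighbours:
  assumes S: "constants_loaded R" "R 3 = 3"
    and u: "u < N" "R 14 = u * N"
    and range: "R 11 = lo" "R 12 = hi" "lo \<le> hi" "hi \<le> N"
    and codes: "R 16 = rank codes (u * N + lo)" "R 17 = rank codes (u * N + hi)"
    and ans: "R 0 + nbr_sum u {lo..<hi} \<le> N * N * N"
    and Q: "\<And>t R' X'. t \<le> deg_in {lo..<hi} u * (18 * j + 19) + 2 \<Longrightarrow>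
      R' 0 = R 0 + nbr_sum u {lo..<hi} \<Longrightarrow>
      \<forall>r. r \<notin> {0, 16, 18} \<union> {4..8} \<longrightarrow> R' r = R r \<Longrightarrow> Q t R' X'"
  shows "wp w structure_image sum_neighbours Q R X"
proof -
  let ?S = "{lo..<hi}" and ?s = "rank codes (u * N + lo)" and ?e = "rank codes (u * N + hi)"
  define f where "f = (\<lambda>i. code_list ! i - u * N)"
  have bij: "bij_betw f {?s..<?e} {v \<in> ?S. adj u v}"
    unfolding f_def by (rule bij_betw_neighbours[OF range(4)])
  have total: "(\<Sum>i\<in>{?s..<?e}. deg_in ?S (f i)) = nbr_sum u ?S"
    unfolding nbr_sum_def using bij by (rule sum.reindex_bij_betw)
  have diff: "?e = ?s + deg_in ?S u"
    using range(3,4) by (rule rank_codes)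
  define I where "I = (\<lambda>b R' (X' :: nat \<Rightarrow> real). b = (?e - R' 16) * (18 * j + 19) + 2 \<and>
    ?s \<le> R' 16 \<and> R' 16 \<le> ?e \<and> R' 0 = R 0 + (\<Sum>i\<in>{?s..<R' 16}. deg_in ?S (f i)) \<and>
    (\<forall>r. r \<notin> {0, 16, 18} \<union> {4..8} \<longrightarrow> R' r = R r))"
  have loop: "wp w structure_image
      (Do (Add 8 3 16) ;; Do (Load 8 8) ;; Do (Sub 8 8 14) ;; Do (Mul 18 8 2) ;;
       code_rank 18 12 ;; Do (Add 0 0 4) ;; code_rank 18 11 ;; Do (Sub 0 0 4) ;; Do (Add 16 16 1))
      (\<lambda>t R' X'. \<exists>b'. b' + t + 2 \<le> b \<and> I b' R' X') R' X'"
    if I: "I b R' X'" and less: "holds (Less 16 17) R' X'" for b R' X'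
  proof -
    define i where "i = R' 16"
    have i: "?s \<le> i" "i < ?e"
      using I less codes unfolding I_def i_def by auto
    have "i < L"
      using i(2) rank_le_card[OF finite_codes, of "u * N + hi"] by linarith
    have "f i \<in> {v \<in> ?S. adj u v}"
      using bij i unfolding bij_betw_def by auto
    then have v: "lo \<le> f i" "f i < hi" "f i < N"
      using range(4) by auto
    have load: "words_image ! (3 + i) = u * N + f i"
    proof -
      have "code_list ! i \<in> {e \<in> codes. u * N + lo \<le> e \<and> e < u * N + hi}"
        using bij_betw_nth_rank[OF finite_codes, of "u * N + lo" "u * N + hi"] i
        unfolding bij_betw_def by auto
      then show ?thesis
        unfolding f_def image_code[OF \<open>i < L\<close>] by simp
    qed
    have Suc_sum: "(\<Sum>i\<in>{?s..<Suc i}. deg_in ?S (f i)) =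
        (\<Sum>i\<in>{?s..<i}. deg_in ?S (f i)) + deg_in ?S (f i)"
      using i by simp
    \<comment> \<open>Partial sums of non-negative terms stay below the complete sum, which excludes
      overflow in the middle of the loop.\<close>
    have "(\<Sum>i\<in>{?s..<Suc i}. deg_in ?S (f i)) \<le> nbr_sum u ?S"
      unfolding total[symmetric] using i by (intro sum_mono2) auto
    then have ans': "R' 0 + deg_in ?S (f i) \<le> N * N * N"
      using ans I Suc_sum unfolding I_def i_def by simp
    have rank: "rank codes (f i * N + hi) = rank codes (f i * N + lo) + deg_in ?S (f i)"
      using range(3,4) by (rule rank_codes)
    have rank_le: "rank codes x \<le> L" for x
      by (rule rank_le_card) simp
    have frame: "\<forall>r. r \<notin> {0, 16, 18} \<union> {4..8} \<longrightarrow> R' r = R r"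
      using I unfolding I_def by blast
    have bounds: "u * N + f i \<le> N * N" "f i * N + lo \<le> N * N" "f i * N + hi \<le> N * N"
      using u(1) v range by (auto intro: code_bound)
    obtain d where d: "?e - i = Suc d" "?e - Suc i = d"
      using i(2) by (metis Suc_diff_Suc)
    have final: "\<exists>b'. b' + t + 2 \<le> b \<and> I b' R1 X1"
      if "t \<le> 18 * j + 17" "R1 0 = R' 0 + deg_in ?S (f i)" "R1 16 = Suc i"
        "\<forall>r. r \<notin> {0, 16, 18} \<union> {4..8} \<longrightarrow> R1 r = R r" for t R1 X1
    proof (intro exI conjI)
      show "d * (18 * j + 19) + 2 + t + 2 \<le> b"
        using that(1) I d(1) unfolding I_def i_def[symmetric] by simp
      show "I (d * (18 * j + 19) + 2) R1 X1"
        using that(2-) I d i Suc_sum unfolding I_def i_def[symmetric] by simp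
    qed
    have regs: "R' 1 = 1" "R' 2 = N" "R' 3 = 3" "R' 11 = lo" "R' 12 = hi" "R' 14 = u * N"
      "R' 16 = i" "constants_loaded R'"
      using S u(2) range frame unfolding constants_loaded_def i_def by simp_all
    then show ?thesis
      using frame words bounds load rank ans' \<open>i < L\<close> rank_le[of "f i * N + hi"] codes_bound
    proof (intro wp_intros wp_code_rank final)
    qed (simp_all add: constants_loaded_def length_words_image)
  qed
  have exit: "2 \<le> b \<and> R' 0 = R 0 + nbr_sum u ?S \<and>
      (\<forall>r. r \<notin> {0, 16, 18} \<union> {4..8} \<longrightarrow> R' r = R r)"
    if "I b R' X'" "\<not> holds (Less 16 17) R' X'" for b R' X'
  proof -
    have "R' 16 = ?e"
      using that codes(2) unfolding I_def by auto
    with that(1) show ?thesis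
      unfolding I_def total[symmetric] by simp
  qed
  have start: "I (deg_in ?S u * (18 * j + 19) + 2) R X"
    unfolding I_def using codes(1) diff by simp
  have "wp w structure_image sum_neighbours
      (\<lambda>t R' X'. t \<le> deg_in ?S u * (18 * j + 19) + 2 \<and> R' 0 = R 0 + nbr_sum u ?S \<and>
        (\<forall>r. r \<notin> {0, 16, 18} \<union> {4..8} \<longrightarrow> R' r = R r)) R X"
    unfolding sum_neighbours_def by (rule wp_While[where I = I, OF start loop exit])
  then show ?thesis
    by (rule wp_mono) (rule Q, auto)
qed

text \<open>Beyond the neighbour loop there are two rank searches and eight instructions; with the
  two steps for leaving the loop they make up \<open>18 * j + 20\<close>.\<close>

lemma wp_add_vertex:
  assumes S: "constants_loaded R" "R 3 = 3"
    and u: "R 15 = u" "u < N" "u \<notin> {lo..<hi}"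
    and range: "R 11 = lo" "R 12 = hi" "lo \<le> hi" "hi \<le> N"
    and ans: "R 0 = wedges {lo..<hi}"
    and Q: "\<And>t R' X'. t \<le> degree u * (18 * j + 19) + (18 * j + 20) \<Longrightarrow>
      R' 0 = wedges (insert u {lo..<hi}) \<Longrightarrow>
      \<forall>r. r \<notin> {0, 14, 16, 17, 18} \<union> {4..8} \<longrightarrow> R' r = R r \<Longrightarrow> Q t R' X'"
  shows "wp w structure_image add_vertex Q R X"
proof -
  define d where "d = deg_in {lo..<hi} u"
  define W where "W = wedges {lo..<hi}"
  define T where "T = nbr_sum u {lo..<hi}"
  have d: "d * (18 * j + 19) \<le> degree u * (18 * j + 19)"
    unfolding d_def using range(4) by (intro mult_right_mono deg_in_le_degree) auto
  have "d \<le> N"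
    unfolding d_def deg_in_def using card_mono[of "{..<N}" "{v \<in> {lo..<hi}. adj u v}"] range(4)
    by force
  then have dd: "d * d \<le> N * N"
    by (simp add: mult_le_mono)
  have choose: "(d * d - d) div 2 = d choose 2"
    by (simp add: choose_two diff_mult_distrib2)
  have W: "wedges (insert u {lo..<hi}) = W + (d choose 2) + T"
    unfolding d_def W_def T_def nbr_sum_def using u(3) by (intro wedges_insert) auto
  \<comment> \<open>All increments are non-negative, so bounding the final count bounds every
    intermediate value of register 0 up to the excess of a single rank.\<close>
  have "wedges (insert u {lo..<hi}) \<le> N * N * N"
    using range u by (intro wedges_le) auto
  then have ans': "W + (d choose 2) + T \<le> N * N * N"
    unfolding W .
  have rank: "rank codes (u * N + hi) = rank codes (u * N + lo) + d"
    unfolding d_def using range(3,4) by (rule rank_codes)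
  have rank_le: "rank codes (u * N + hi) \<le> L"
    by (rule rank_le_card) simp
  have bounds: "u * N + lo \<le> N * N" "u * N + hi \<le> N * N"
    using u range by (auto intro: code_bound)
  have final: "Q t R1 X1"
    if "t \<le> d * (18 * j + 19) + (18 * j + 20)" "R1 0 = W + (d choose 2) + T"
      "\<forall>r. r \<notin> {0, 14, 16, 17, 18} \<union> {4..8} \<longrightarrow> R1 r = R r" for t R1 X1
  proof (rule Q)
    show "t \<le> degree u * (18 * j + 19) + (18 * j + 20)"
      using that(1) d by linarith
  qed (use that W in simp_all)
  have regs: "R 1 = 1" "R 2 = N" "R 13 = L" "R 19 = K" "R 22 = 2" "R 23 = 3"
    using S(1) unfolding constants_loaded_def by simp_all
  have uN: "u * N < 2 ^ w" "u * N + lo < 2 ^ w" "u * N + hi < 2 ^ w"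
    using bounds words by linarith+
  have small: "rank codes (u * N + lo) + d < 2 ^ w" "d * d < 2 ^ w" "W + (d choose 2) < 2 ^ w"
    using rank rank_le codes_bound words dd ans' by linarith+
  show ?thesis
    using regs S(2) u(1,2) range ans[folded W_def] rank uN small ans' choose
    unfolding add_vertex_def
  proof (intro wp_intros wp_code_rank final
      wp_sum_neighbours[where u = u and lo = lo and hi = hi])
  qed (simp_all add: constants_loaded_def d_def[symmetric] T_def[symmetric])
qed

end

section \<open>Nearest boundaries and growth of the counted range\<close>

lemma sorted_list_rank_least:
  assumes "finite A" "y \<in> A" "a \<le> y"
  shows "rank A a < card A" "sorted_list_of_set A ! rank A a \<in> A"
    "a \<le> sorted_list_of_set A ! rank A a" "sorted_list_of_set A ! rank A a \<le> y"
proof -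
  let ?xs = "sorted_list_of_set A"
  obtain i where i: "i < card A" "?xs ! i = y"
    using assms(1,2) by (metis in_set_conv_nth length_sorted_list_of_set set_sorted_list_of_set)
  then have "rank A a \<le> i"
    using nth_sorted_list_less_iff[OF assms(1) i(1), of a] assms(3) by auto
  with i show less: "rank A a < card A"
    by simp
  show "?xs ! rank A a \<in> A"
    using nth_mem[of "rank A a" ?xs] less assms(1) by simp
  show "a \<le> ?xs ! rank A a"
    using nth_sorted_list_less_iff[OF assms(1) less, of a] by auto
  show "?xs ! rank A a \<le> y"
    using sorted_nth_mono[of ?xs "rank A a" i] \<open>rank A a \<le> i\<close> i by simp
qed

text \<open>The rank of \<open>b + 1\<close> counts the elements up to \<open>b\<close>. The witness
  \<open>y\<close> makes it positive, so the truncated subtraction of 1 is harmless.\<close>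

lemma sorted_list_rank_greatest:
  fixes A :: "nat set"
  assumes "finite A" "y \<in> A" "y \<le> b"
  defines "i \<equiv> rank A (b + 1) - 1"
  shows "0 < rank A (b + 1)" "i < card A" "sorted_list_of_set A ! i \<in> A"
    "sorted_list_of_set A ! i \<le> b" "y \<le> sorted_list_of_set A ! i"
proof -
  let ?xs = "sorted_list_of_set A"
  obtain k where k: "k < card A" "?xs ! k = y"
    using assms(1,2) by (metis in_set_conv_nth length_sorted_list_of_set set_sorted_list_of_set)
  then have less: "k < rank A (b + 1)"
    using nth_sorted_list_less_iff[OF assms(1) k(1), of "b + 1"] assms(3) by auto
  then show "0 < rank A (b + 1)"
    by simp
  show i: "i < card A"
    using less rank_le_card[OF assms(1), of "b + 1"] unfolding i_def by simp
  show "?xs ! i \<in> A"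
    using nth_mem[of i ?xs] i assms(1) by simp
  show "?xs ! i \<le> b"
    using nth_sorted_list_less_iff[OF assms(1) i, of "b + 1"] less unfolding i_def by auto
  show "y \<le> ?xs ! i"
    using sorted_nth_mono[of ?xs k i] less i k unfolding i_def by simp
qed

context rank_structure
begin

text \<open>The quantity multiplied by \<open>36 * j + 49\<close> is the total degree of the
  vertices still to be added. The factor is \<open>18 * j + 19\<close> per incidence plus the fixed
  cost \<open>18 * j + 30\<close> of a vertex, charged to its degree.\<close>

lemma wp_extend:
  assumes S: "constants_loaded R" "R 3 = 3"
    and query: "R 9 = a" "R 10 = b" "b \<le> N"
    and range: "R 11 = lo" "R 12 = hi" "a \<le> lo" "lo \<le> hi" "hi \<le> b"
    and regs: "R 25 = b - a" "R 26 = hi - lo"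
    and ans: "R 0 = wedges {lo..<hi}"
    and Q: "\<And>t R' X'.
      t \<le> (offset lo - offset a + (offset b - offset hi)) * (36 * j + 49) + 2 \<Longrightarrow>
      R' 0 = wedges {a..<b} \<Longrightarrow> Q t R' X'"
  shows "wp w structure_image extend Q R X"
proof -
  let ?work = "\<lambda>lo hi. offset lo - offset a + (offset b - offset hi)"
  define I where "I = (\<lambda>n R' (X' :: nat \<Rightarrow> real). n = ?work (R' 11) (R' 12) * (36 * j + 49) + 2 \<and>
    constants_loaded R' \<and> R' 3 = 3 \<and> R' 9 = a \<and> R' 10 = b \<and> R' 25 = b - a \<and>
    a \<le> R' 11 \<and> R' 11 \<le> R' 12 \<and> R' 12 \<le> b \<and> R' 26 = R' 12 - R' 11 \<and>
    R' 0 = wedges {R' 11..<R' 12})"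
  have start: "I (?work lo hi * (36 * j + 49) + 2) R X"
    unfolding I_def using assms by simp
  have exit: "2 \<le> n \<and> R' 0 = wedges {a..<b}"
    if "I n R' X'" "\<not> holds (Less 26 25) R' X'" for n R' X'
  proof -
    have "R' 11 = a" "R' 12 = b"
      using that unfolding I_def by auto
    with that(1) show ?thesis
      unfolding I_def by simp
  qed
  have loop: "wp w structure_image
      (Ite (Less 9 11)
        (Do (Sub 15 11 1) ;; Do (Move 27 15) ;; Do (Move 28 12))
        (Do (Move 15 12) ;; Do (Move 27 11) ;; Do (Add 28 12 1)) ;;
       absorb)
      (\<lambda>t R' X'. \<exists>n'. n' + t + 2 \<le> n \<and> I n' R' X') R' X'"
    if I: "I n R' X'" and less: "holds (Less 26 25) R' X'" for n R' X'
  proof -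
    define lo hi where "lo = R' 11" and "hi = R' 12"
    have r: "a \<le> lo" "lo \<le> hi" "hi \<le> b" and const: "constants_loaded R'" and
      regs: "R' 3 = 3" "R' 9 = a" "R' 10 = b" "R' 25 = b - a" "R' 26 = hi - lo"
      "R' 0 = wedges {lo..<hi}" "R' 11 = lo" "R' 12 = hi" and
      n: "n = ?work lo hi * (36 * j + 49) + 2"
      using I unfolding I_def lo_def hi_def by auto
    \<comment> \<open>One statement covers growth at either end; \<open>k\<close> counts the steps
      already spent on choosing the end.\<close>
    have add: "wp w structure_image absorb
        (\<lambda>t R' X'. \<exists>n'. n' + (k + t) + 2 \<le> n \<and> I n' R' X') R1 X1"
      if R1: "R1 15 = u" "R1 27 = lo'" "R1 28 = hi'"
          "\<forall>r. r \<notin> {15, 27, 28} \<longrightarrow> R1 r = R' r"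
        and u: "u < N" "u \<notin> {lo..<hi}" "insert u {lo..<hi} = {lo'..<hi'}"
        and r': "a \<le> lo'" "lo' \<le> hi'" "hi' \<le> b"
        and work: "?work lo hi = ?work lo' hi' + degree u" and k: "k \<le> 5"
      for R1 X1 u lo' hi' k
    proof -
      \<comment> \<open>The fixed cost is \<open>18 * j + 20\<close> from \<open>add_vertex\<close>,
        3 for updating the range, at most 5 for choosing the end and 2 for the loop.\<close>
      have "degree u * (18 * j + 19) + (18 * j + 30) \<le> degree u * (36 * j + 49)"
      proof -
        have "1 * (18 * j + 30) \<le> degree u * (18 * j + 30)"
          using degree_pos[OF u(1)] by (intro mult_right_mono) auto
        then show ?thesis
          by (simp add: algebra_simps)
      qed
      then have time: "?work lo' hi' * (36 * j + 49) + 2 + (k + t) + 2 \<le> n"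
        if "t \<le> degree u * (18 * j + 19) + (18 * j + 23)" for t
        using that k unfolding n work by (simp add: add_mult_distrib)
      have final: "\<exists>n'. n' + (k + t) + 2 \<le> n \<and> I n' R2 X2"
        if "t \<le> degree u * (18 * j + 19) + (18 * j + 23)" "R2 0 = wedges {lo'..<hi'}"
          "R2 11 = lo'" "R2 12 = hi'" "R2 26 = hi' - lo'"
          "\<forall>r. r \<notin> {0, 11, 12, 14, 15, 16, 17, 18, 26, 27, 28} \<union> {4..8} \<longrightarrow> R2 r = R' r"
        for t R2 X2
      proof (intro exI conjI)
        show "I (?work lo' hi' * (36 * j + 49) + 2) R2 X2"
          using that(2-) regs const r' unfolding I_def constants_loaded_def by simp
      qed (rule time[OF that(1)])
      have "constants_loaded R1"
        using const R1(4) unfolding constants_loaded_def by auto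
      moreover have "R1 3 = 3" "R1 11 = lo" "R1 12 = hi" "R1 0 = wedges {lo..<hi}"
        using regs R1(4) by simp_all
      moreover have "hi \<le> N" "hi' < 2 ^ w"
        using r r' query(3) words by linarith+
      ultimately show ?thesis
        using R1 u r r' unfolding absorb_def
      proof (intro wp_intros wp_add_vertex[where u = u and lo = lo and hi = hi] final)
      qed simp_all
    qed
    have one: "R' 1 = 1"
      using const unfolding constants_loaded_def by simp
    have bounds: "lo < 2 ^ w" "hi < 2 ^ w" "Suc b < 2 ^ w"
      using r query(3) words by linarith+
    show ?thesis
    proof (cases "a < lo")
      case True
      define u where "u = lo - 1"
      have u: "lo = Suc u" "a \<le> u"
        using True unfolding u_def by auto
      have work: "?work lo hi = ?work u hi + degree u"
        using offset_mono[OF u(2)] unfolding u(1) offset_Suc by simp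
      have insert: "insert u {lo..<hi} = {u..<hi}"
        using u r by auto
      have u': "lo - 1 = u" "a \<le> u" "u \<le> hi" "u < N" "u < lo"
        using u r query(3) by auto
      show ?thesis
        using True u' r query(3) regs one bounds
      proof (intro wp_intros wp_Ite add[OF _ _ _ _ _ _ insert _ _ _ work])
      qed simp_all
    next
      case False
      \<comment> \<open>The left end has already reached \<open>a\<close>, so the missing length
        must be on the right.\<close>
      then have "hi < b"
        using less regs r by simp
      then have work: "?work lo hi = ?work lo (Suc hi) + degree hi"
        using offset_mono[of "Suc hi" b] unfolding offset_Suc by simp
      have insert: "insert hi {lo..<hi} = {lo..<Suc hi}"
        using r by auto
      show ?thesis
        using False \<open>hi < b\<close> r query(3) regs one bounds
      proof (intro wp_intros wp_Ite add[OF _ _ _ _ _ _ insert _ _ _ work])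
      qed simp_all
    qed
  qed
  have "wp w structure_image extend
      (\<lambda>t R' X'. t \<le> ?work lo hi * (36 * j + 49) + 2 \<and> R' 0 = wedges {a..<b}) R X"
    unfolding extend_def by (rule wp_While[where I = I, OF start loop exit])
  then show ?thesis
    by (rule wp_mono) (rule Q, auto)
qed

section \<open>Locating the query endpoints\<close>

lemma wp_lower_real_body:
  assumes "R 1 = 1" "X 0 = x"
    and frame: "\<forall>r. r \<notin> {4, 5, 7, 8} \<longrightarrow> R' r = R r" "\<forall>r. r \<noteq> 2 \<longrightarrow> X' r = X r"
    and less: "R' 7 < N"
  shows "wp w structure_image lower_real_body (\<lambda>t R'' X''. t \<le> 4 \<and>
    (\<forall>r. r \<notin> {4, 5, 7, 8} \<longrightarrow> R'' r = R r) \<and> (\<forall>r. r \<noteq> 2 \<longrightarrow> X'' r = X r) \<and>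
    R'' 4 = (if vals ! R' 7 < x then R' 7 + 1 else R' 4) \<and>
    R'' 5 = (if vals ! R' 7 < x then R' 5 else R' 7)) R' X'"
  using assms words length_vals unfolding lower_real_body_def
  by (intro wp_intros wp_Ite) auto

lemma wp_upper_real_body:
  assumes "R 1 = 1" "X 1 = x"
    and frame: "\<forall>r. r \<notin> {4, 5, 7, 8} \<longrightarrow> R' r = R r" "\<forall>r. r \<noteq> 2 \<longrightarrow> X' r = X r"
    and less: "R' 7 < N"
  shows "wp w structure_image upper_real_body (\<lambda>t R'' X''. t \<le> 4 \<and>
    (\<forall>r. r \<notin> {4, 5, 7, 8} \<longrightarrow> R'' r = R r) \<and> (\<forall>r. r \<noteq> 2 \<longrightarrow> X'' r = X r) \<and>
    R'' 4 = (if vals ! R' 7 \<le> x then R' 7 + 1 else R' 4) \<and>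
    R'' 5 = (if vals ! R' 7 \<le> x then R' 5 else R' 7)) R' X'"
  using assms words length_vals unfolding upper_real_body_def
  by (intro wp_intros wp_Ite) auto

lemma wp_find_range:
  assumes const: "constants_loaded R" and X: "X 0 = x1" "X 1 = x2"
    and Q: "\<And>t R' X'. t \<le> 16 * j + 10 \<Longrightarrow>
      \<forall>r. r \<notin> {4, 5, 7, 8, 9, 10} \<longrightarrow> R' r = R r \<Longrightarrow>
      R' 9 = card {i. i < N \<and> vals ! i < x1} \<Longrightarrow> R' 10 = card {i. i < N \<and> vals ! i \<le> x2} \<Longrightarrow>
      Q t R' X'"
  shows "wp w structure_image find_range Q R X"
proof -
  have mono: "vals ! i \<le> vals ! i'" if "i < i'" "i' < N" for i i'
    using that sorted_nth_mono[OF sorted_vals, of i i'] length_vals by simp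
  have bounds: "N < 2 ^ j" "2 * N < 2 ^ w"
    using log words le_square[of N] by linarith+
  have lower: "wp w structure_image (bsearch lower_real_body) Q' R' X'"
    if "constants_loaded R'" "R' 5 = N" "X' 0 = x1"
      "\<And>t R'' X''. t \<le> 8 * j + 3 \<Longrightarrow> \<forall>r. r \<notin> {4, 5, 7, 8} \<longrightarrow> R'' r = R' r \<Longrightarrow>
        \<forall>r. r \<noteq> 2 \<longrightarrow> X'' r = X' r \<Longrightarrow> R'' 4 = card {i. i < N \<and> vals ! i < x1} \<Longrightarrow> Q' t R'' X''"
    for Q' R' X'
    proof (rule wp_bsearch[where P = "\<lambda>i. vals ! i < x1" and k = 4 and R = R' and X = X',
        OF that(2) bounds])
    show "vals ! i' < x1" if "i' < i" "i < N" "vals ! i < x1" for i i'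
      using mono[OF that(1,2)] that(3) by simp
  next
    fix R'' X''
    assume "\<forall>r. r \<notin> {4, 5, 7, 8} \<longrightarrow> R'' r = R' r" "\<forall>r. r \<noteq> 2 \<longrightarrow> X'' r = X' r" "R'' 7 < N"
    then show "wp w structure_image lower_real_body (\<lambda>t R3 X3. t \<le> 4 \<and>
        (\<forall>r. r \<notin> {4, 5, 7, 8} \<longrightarrow> R3 r = R' r) \<and> (\<forall>r. r \<noteq> 2 \<longrightarrow> X3 r = X' r) \<and>
        R3 4 = (if vals ! R'' 7 < x1 then R'' 7 + 1 else R'' 4) \<and>
        R3 5 = (if vals ! R'' 7 < x1 then R'' 5 else R'' 7)) R'' X''"
      using that(1,3) by (intro wp_lower_real_body) (simp_all add: constants_loaded_def)
  qed (use that in \<open>simp_all add: constants_loaded_def mult.commute\<close>)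
  have upper: "wp w structure_image (bsearch upper_real_body) Q' R' X'"
    if "constants_loaded R'" "R' 5 = N" "X' 1 = x2"
      "\<And>t R'' X''. t \<le> 8 * j + 3 \<Longrightarrow> \<forall>r. r \<notin> {4, 5, 7, 8} \<longrightarrow> R'' r = R' r \<Longrightarrow>
        \<forall>r. r \<noteq> 2 \<longrightarrow> X'' r = X' r \<Longrightarrow> R'' 4 = card {i. i < N \<and> vals ! i \<le> x2} \<Longrightarrow> Q' t R'' X''"
    for Q' R' X'
    proof (rule wp_bsearch[where P = "\<lambda>i. vals ! i \<le> x2" and k = 4 and R = R' and X = X',
        OF that(2) bounds])
    show "vals ! i' \<le> x2" if "i' < i" "i < N" "vals ! i \<le> x2" for i i'
      using mono[OF that(1,2)] that(3) by simp
  next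
    fix R'' X''
    assume "\<forall>r. r \<notin> {4, 5, 7, 8} \<longrightarrow> R'' r = R' r" "\<forall>r. r \<noteq> 2 \<longrightarrow> X'' r = X' r" "R'' 7 < N"
    then show "wp w structure_image upper_real_body (\<lambda>t R3 X3. t \<le> 4 \<and>
        (\<forall>r. r \<notin> {4, 5, 7, 8} \<longrightarrow> R3 r = R' r) \<and> (\<forall>r. r \<noteq> 2 \<longrightarrow> X3 r = X' r) \<and>
        R3 4 = (if vals ! R'' 7 \<le> x2 then R'' 7 + 1 else R'' 4) \<and>
        R3 5 = (if vals ! R'' 7 \<le> x2 then R'' 5 else R'' 7)) R'' X''"
      using that(1,3) by (intro wp_upper_real_body) (simp_all add: constants_loaded_def)
  qed (use that in \<open>simp_all add: constants_loaded_def mult.commute\<close>)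
  show ?thesis
    using const X unfolding find_range_def
  proof (intro wp_intros lower upper Q)
  qed (simp_all add: constants_loaded_def)
qed

lemma wp_find_blocks:
  assumes const: "constants_loaded R" and query: "R 9 = a" "R 10 = b" "a \<le> N" "b \<le> N"
  defines "ka \<equiv> rank (boundaries l) a" and "kb \<equiv> rank (boundaries l) (b + 1) - 1"
  assumes Q: "\<And>t R' X'. t \<le> 18 * j + 18 \<Longrightarrow> constants_loaded R' \<Longrightarrow> R' 0 = R 0 \<Longrightarrow>
      R' 9 = a \<Longrightarrow> R' 10 = b \<Longrightarrow> R' 20 = 3 + L \<Longrightarrow> R' 21 = ka \<Longrightarrow> R' 24 = kb \<Longrightarrow>
      R' 11 = boundary_list ! ka \<Longrightarrow> R' 12 = boundary_list ! kb \<Longrightarrow> Q t R' X'"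
  shows "wp w structure_image find_blocks Q R X"
proof -
  have mem: "0 \<in> boundaries l" "N \<in> boundaries l"
    by (simp_all add: boundaries_def)
  have ka: "ka < K"
    unfolding ka_def using sorted_list_rank_least(1)[OF _ mem(2) query(3)] by simp
  have kb: "0 < rank (boundaries l) (b + 1)" "kb < K"
    unfolding kb_def using sorted_list_rank_greatest(1,2)[OF _ mem(1), of b] by simp_all
  have kb': "rank (boundaries l) (b + 1) \<le> K"
    by (rule rank_le_card) simp
  have regs: "R 1 = 1" "R 2 = N" "R 13 = L" "R 19 = K" "R 22 = 2" "R 23 = 3"
    using const unfolding constants_loaded_def by simp_all
  have ranks: "rank (boundaries l) a = ka" "rank (boundaries l) (Suc b) = Suc kb"
    using kb unfolding ka_def kb_def by simp_all
  have loads: "words_image ! (3 + L + ka) = boundary_list ! ka"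
    "words_image ! (3 + L + kb) = boundary_list ! kb"
    using ka kb by (simp_all add: image_boundary)
  have bounds: "3 + L + K < 2 ^ w" "Suc b < 2 ^ w" "2 * K < 2 ^ w" "K < 2 ^ j"
    "3 + L + ka < 2 ^ w" "3 + L + kb < 2 ^ w" "Suc kb < 2 ^ w"
    using words log query(4) ka kb by linarith+
  show ?thesis
    using regs query ka kb(2) ranks loads bounds unfolding find_blocks_def
  proof (intro wp_intros wp_word_search[where A = "boundaries l"] Q)
  qed (simp_all add: constants_loaded_def image_boundary length_words_image)
qed

end

context rank_structure
begin

section \<open>Running the whole query\<close>

lemma wp_start_count:
  assumes const: "constants_loaded R"
    and regs: "R 0 = 0" "R 9 = a" "R 10 = b" "R 20 = 3 + L" "R 21 = ka" "R 24 = kb" "R 11 = lo" "R 12 = hi"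
    and index: "ka < K" "kb < K" "boundary_list ! ka = lo" "boundary_list ! kb = hi"
    and le: "a \<le> b" "b \<le> N" "a \<le> lo" "lo \<le> N" "hi \<le> b"
    and Q: "\<And>t R' X' lo' hi'. t \<le> 10 \<Longrightarrow> constants_loaded R' \<Longrightarrow> R' 3 = 3 \<Longrightarrow>
      R' 9 = a \<Longrightarrow> R' 10 = b \<Longrightarrow> R' 11 = lo' \<Longrightarrow> R' 12 = hi' \<Longrightarrow> R' 25 = b - a \<Longrightarrow>
      R' 26 = hi' - lo' \<Longrightarrow> R' 0 = wedges {lo'..<hi'} \<Longrightarrow>
      lo' = (if hi < lo then a else lo) \<Longrightarrow> hi' = (if hi < lo then a else hi) \<Longrightarrow>
      Q t R' X'"
  shows "wp w structure_image start_count Q R X"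
proof -
  have const': "R 1 = 1" "R 2 = N" "R 13 = L" "R 19 = K" "R 22 = 2" "R 23 = 3"
    using const unfolding constants_loaded_def by simp_all
  have "Suc ka * K \<le> K * K"
    using index(1) by (intro mult_right_mono) auto
  then have cell: "ka * K + kb < K * K"
    using index(2) by simp
  have load: "words_image ! (ka * K + kb + (3 + L) + K) = wedges {lo..<hi}"
    using image_table[OF index(1,2)] unfolding index(3,4) by (simp add: add_ac)
  have bounds: "ka * K < 2 ^ w" "ka * K + kb < 2 ^ w" "ka * K + kb + (3 + L) < 2 ^ w"
    "ka * K + kb + (3 + L) + K < 2 ^ w" "b < 2 ^ w" "hi < 2 ^ w" "a < 2 ^ w"
    using cell words le by linarith+
  show ?thesis
  proof (cases "hi < lo")
    case True
    have Q': "Q t R' X'"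
      if "t \<le> 10" "constants_loaded R'" "R' 3 = 3" "R' 9 = a" "R' 10 = b" "R' 11 = a" "R' 12 = a"
        "R' 25 = b - a" "R' 26 = 0" "R' 0 = 0" for t R' X'
      using that True by (intro Q[of t R' a a]) simp_all
    show ?thesis
      using True regs const' le bounds(5-7) unfolding start_count_def
    proof (intro wp_intros wp_Ite Q')
    qed (simp_all add: constants_loaded_def)
  next
    case False
    have Q': "Q t R' X'"
      if "t \<le> 10" "constants_loaded R'" "R' 3 = 3" "R' 9 = a" "R' 10 = b" "R' 11 = lo" "R' 12 = hi"
        "R' 25 = b - a" "R' 26 = hi - lo" "R' 0 = wedges {lo..<hi}" for t R' X'
      using that False by (intro Q[of t R' lo hi]) simp_all
    show ?thesis
      using False regs const' le bounds load cell unfolding start_count_def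
    proof (intro wp_intros wp_Ite Q')
    qed (simp_all add: constants_loaded_def length_words_image)
  qed
qed

lemma wp_load_header:
  assumes "R 0 = 0"
    and Q: "\<And>t R' X'. t \<le> 6 \<Longrightarrow> constants_loaded R' \<Longrightarrow> R' 0 = 0 \<Longrightarrow> Q t R' X"
  shows "wp w structure_image load_header Q R X"
proof -
  have "(3 :: nat) < 2 ^ w"
    using words by linarith
  then show ?thesis
    using assms(1) unfolding load_header_def
  proof (intro wp_intros Q)
  qed (simp_all add: constants_loaded_def image_header length_words_image)
qed

text \<open>Everything outside the growth loop, including its exit, costs
  \<open>34 * j + 46\<close>; growth costs \<open>2 * l * (36 * j + 49)\<close>. Multiplying the
  first term by \<open>l\<close> as well gives the stated bound.\<close>

lemma wp_query_code:
  assumes "x1 \<le> x2"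
  defines "a \<equiv> card {i. i < N \<and> vals ! i < x1}" and "b \<equiv> card {i. i < N \<and> vals ! i \<le> x2}"
  shows "wp w structure_image query_code
    (\<lambda>t R X. t \<le> l * (106 * j + 144) \<and> R 0 = wedges {a..<b}) (\<lambda>_. 0) ((\<lambda>_. 0)(0 := x1, 1 := x2))"
proof -
  have b: "b \<le> N"
    unfolding b_def using card_mono[of "{..<N}" "{i. i < N \<and> vals ! i \<le> x2}"] by auto
  have ab: "a \<le> b"
    unfolding a_def b_def by (intro card_mono) (use assms(1) in auto)
  have mem: "0 \<in> boundaries l" "N \<in> boundaries l"
    by (simp_all add: boundaries_def)
  define ka kb where "ka = rank (boundaries l) a" and "kb = rank (boundaries l) (b + 1) - 1"
  define lo hi where "lo = boundary_list ! ka" and "hi = boundary_list ! kb"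
  have "a \<le> N"
    using ab b by simp
  note least = sorted_list_rank_least[OF finite_boundaries, of _ l a, folded ka_def, folded lo_def]
  note greatest = sorted_list_rank_greatest[OF finite_boundaries, of _ l b, folded kb_def, folded hi_def]
  have lo: "ka < K" "a \<le> lo" "lo \<le> N"
    using least[OF mem(2) \<open>a \<le> N\<close>] by simp_all
  have hi: "kb < K" "hi \<le> b"
    using greatest[OF mem(1)] by simp_all
  have lo_least: "lo \<le> v" if "v \<in> boundaries l" "a \<le> v" for v
    using least(4) that by blast
  have hi_greatest: "v \<le> hi" if "v \<in> boundaries l" "v \<le> b" for v
    using greatest(5) that by blast
  have crossing: "v \<in> boundaries l \<and> Suc v \<in> boundaries l" if "v \<in> crossing l" for v
    using that unfolding boundaries_def by auto
  define lo' hi' where "lo' = (if hi < lo then a else lo)" and "hi' = (if hi < lo then a else hi)"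
  have range: "a \<le> lo'" "lo' \<le> hi'" "hi' \<le> b"
    using lo hi ab unfolding lo'_def hi'_def by auto
  \<comment> \<open>A crossing vertex left of \<open>lo\<close> would be an earlier boundary from
    \<open>a\<close> on, and the end of one right of \<open>hi\<close> a later boundary up to
    \<open>b\<close>. Each remainder is therefore free of crossings; if \<open>hi < lo\<close>, the
    whole query range is.\<close>
  have work: "offset lo' - offset a + (offset b - offset hi') \<le> 2 * l"
  proof (cases "hi < lo")
    case True
    have "offset b - offset a < l"
    proof (rule offset_diff_less[OF l_pos ab b])
      fix v
      assume "a \<le> v" "v < b"
      then show "v \<notin> crossing l"
        using crossing[of v] lo_least[of v] hi_greatest[of v] True by linarith
    qed
    with True show ?thesis
      unfolding lo'_def hi'_def by simp
  next
    case False
    have "offset lo - offset a < l"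
    proof (rule offset_diff_less[OF l_pos lo(2,3)])
      fix v
      assume "a \<le> v" "v < lo"
      then show "v \<notin> crossing l"
        using crossing[of v] lo_least[of v] by linarith
    qed
    moreover have "offset b - offset hi < l"
    proof (rule offset_diff_less[OF l_pos hi(2) b])
      fix v
      assume "hi \<le> v" "v < b"
      then show "v \<notin> crossing l"
        using crossing[of v] hi_greatest[of "Suc v"] by linarith
    qed
    ultimately show ?thesis
      using False unfolding lo'_def hi'_def by simp
  qed
  have time: "t1 + (t2 + (t3 + (t4 + t5))) \<le> l * (106 * j + 144)"
    if "t1 \<le> 6" "t2 \<le> 16 * j + 10" "t3 \<le> 18 * j + 18" "t4 \<le> 10"
      "t5 \<le> (offset lo' - offset a + (offset b - offset hi')) * (36 * j + 49) + 2"
    for t1 t2 t3 t4 t5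
  proof -
    define p q where "p = 2 * l * (36 * j + 49)" and "q = l * (34 * j + 46)"
    have "t5 \<le> p + 2"
      using that(5) mult_right_mono[OF work, of "36 * j + 49"] unfolding p_def by linarith
    moreover have "34 * j + 46 \<le> q"
      using l_pos mult_right_mono[of 1 l "34 * j + 46"] unfolding q_def by simp
    moreover have "l * (106 * j + 144) = p + q"
      unfolding p_def q_def by (simp add: algebra_simps)
    ultimately show ?thesis
      using that(1-4) by linarith
  qed
  show ?thesis
    unfolding query_code_def
    apply (rule wp_Seq, rule wp_load_header, simp)
    apply (rule wp_Seq, rule wp_find_range[where ?x1.0 = x1 and ?x2.0 = x2], assumption, simp, simp)
    apply (fold a_def b_def)
    apply (rule wp_Seq, rule wp_find_blocks[where a = a and b = b, folded ka_def kb_def lo_def hi_def])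
    subgoal by (simp add: constants_loaded_def)
    subgoal by simp
    subgoal by simp
    subgoal using \<open>a \<le> N\<close> .
    subgoal using b .
    apply (rule wp_Seq, rule wp_start_count[where a = a and b = b and ka = ka and kb = kb and lo = lo and hi = hi])
    apply (assumption | rule lo hi ab b | simp add: lo_def hi_def; fail)+
    apply (fold lo'_def hi'_def)
    apply (rule wp_extend[where a = a and b = b and lo = lo' and hi = hi'])
    apply (assumption | rule range b | simp;fail)+
    apply (rule conjI, rule time, assumption+)
    done
qed

end

section \<open>Wedge occurrences and ranks of the input graph\<close>

definition adjacent :: "'v ugraph \<Rightarrow> 'v \<Rightarrow> 'v set" where
  "adjacent G v = {u. {v, u} \<in> edges G}"

lemma adjacent_subset:
  assumes "simple_graph G"
  shows "adjacent G v \<subseteq> verts G - {v}"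
  using assms by (auto simp: adjacent_def simple_graph_def)

text \<open>Occurrences are subgraphs and not embeddings, so the two orientations of a path
  coincide: a wedge is a centre with an unordered pair of its neighbours.\<close>

lemma card_occurrences_wedge:
  fixes G :: "'v ugraph"
  assumes "simple_graph G"
  shows "card (occurrences wedge G) = (\<Sum>v\<in>verts G. card (adjacent G v) choose 2)"
proof -
  have fin: "finite (verts G)"
    using assms by (simp add: simple_graph_def)
  have fin_adj: "finite (adjacent G v)" for v
    using adjacent_subset[OF assms] fin by (meson finite_Diff finite_subset)
  define P where "P = (SIGMA v:verts G. {e. e \<subseteq> adjacent G v \<and> card e = 2})"
  define h :: "'v \<times> 'v set \<Rightarrow> 'v ugraph"
    where "h = (\<lambda>(v, e). \<lparr>verts = insert v e, edges = (\<lambda>u. {v, u}) ` e\<rparr>)"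
  have P_D: "\<exists>x y. e = {x, y} \<and> x \<noteq> y \<and> v \<noteq> x \<and> v \<noteq> y \<and> v \<in> verts G \<and>
      {v, x} \<in> edges G \<and> {v, y} \<in> edges G \<and> x \<in> verts G \<and> y \<in> verts G"
    if "(v, e) \<in> P" for v e
  proof -
    from that have e: "e \<subseteq> adjacent G v" "card e = 2" "v \<in> verts G"
      by (auto simp: P_def)
    then obtain x y where "e = {x, y}" "x \<noteq> y"
      by (auto simp: card_2_iff)
    with e adjacent_subset[OF assms, of v] show ?thesis
      by (intro exI[of _ x] exI[of _ y]) (auto simp: adjacent_def)
  qed
  have inj: "inj_on h P"
  proof (rule inj_onI)
    fix p p'
    assume p: "p \<in> P" "p' \<in> P" "h p = h p'"
    obtain v e v' e' where eq: "p = (v, e)" "p' = (v', e')"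
      by (cases p, cases p')
    from p(1)[unfolded eq] P_D obtain x y where e: "e = {x, y}" "x \<noteq> y" "v \<noteq> x" "v \<noteq> y"
      by blast
    from p(2)[unfolded eq] P_D obtain x' y' where
      e': "e' = {x', y'}" "x' \<noteq> y'" "v' \<noteq> x'" "v' \<noteq> y'"
      by blast
    have h: "insert v e = insert v' e'" "(\<lambda>u. {v, u}) ` e = (\<lambda>u. {v', u}) ` e'"
      using p(3) by (simp_all add: eq h_def)
    \<comment> \<open>The centre is recovered as the only common vertex of the two edges.\<close>
    have "\<Inter> ((\<lambda>u. {v, u}) ` e) = {v}" "\<Inter> ((\<lambda>u. {v', u}) ` e') = {v'}"
      using e e' by auto
    then have "v = v'"
      using h(2) by simp
    moreover have "e = insert v e - {v}" "e' = insert v' e' - {v'}"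
      using e e' by auto
    ultimately show "p = p'"
      using h(1) eq by metis
  qed
  have "h ` P = occurrences wedge G"
  proof (intro equalityI subsetI)
    fix H
    assume "H \<in> h ` P"
    then obtain v e where H: "H = h (v, e)" "(v, e) \<in> P"
      by auto
    from P_D[OF H(2)] obtain x y where e: "e = {x, y}" "x \<noteq> y" "v \<noteq> x" "v \<noteq> y" "v \<in> verts G"
      "{v, x} \<in> edges G" "{v, y} \<in> edges G" "x \<in> verts G" "y \<in> verts G"
      by blast
    have sub: "subgraph H G"
      using e by (auto simp: H(1) h_def subgraph_def simple_graph_def)
    define f where "f = (\<lambda>i :: nat. if i = 0 then x else if i = 1 then v else y)"
    have "bij_betw f (verts wedge) (verts H) \<and> edges H = (\<lambda>e. f ` e) ` edges wedge"
      using e by (auto simp: bij_betw_def inj_on_def f_def wedge_def H(1) h_def)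
    with sub show "H \<in> occurrences wedge G"
      unfolding occurrences_def isomorphic_def by blast
  next
    fix H
    assume "H \<in> occurrences wedge G"
    then obtain f where sub: "subgraph H G" and f: "bij_betw f (verts wedge) (verts H)"
      "edges H = (\<lambda>e. f ` e) ` edges wedge"
      unfolding occurrences_def isomorphic_def by blast
    have verts: "verts H = {f 0, f 1, f 2}" and edges: "edges H = {{f 0, f 1}, {f 1, f 2}}"
      using f by (auto simp: bij_betw_def wedge_def)
    have ne: "f 0 \<noteq> f 1" "f 1 \<noteq> f 2" "f 0 \<noteq> f 2"
      using f(1) by (auto simp: bij_betw_def inj_on_def wedge_def)
    have "(f 1, {f 0, f 2}) \<in> P"
      using sub ne unfolding subgraph_def verts edges P_def adjacent_def
      by (auto simp: insert_commute)
    moreover have "H = h (f 1, {f 0, f 2})"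
      unfolding h_def using verts edges by (cases H) (auto simp: insert_commute)
    ultimately show "H \<in> h ` P"
      by blast
  qed
  then have "card (occurrences wedge G) = card P"
    using card_image[OF inj] by simp
  also have "\<dots> = (\<Sum>v\<in>verts G. card {e. e \<subseteq> adjacent G v \<and> card e = 2})"
    unfolding P_def by (rule card_SigmaI) (use fin fin_adj in auto)
  also have "\<dots> = (\<Sum>v\<in>verts G. card (adjacent G v) choose 2)"
    using fin_adj by (simp add: n_subsets)
  finally show ?thesis .
qed

lemma range_count_wedge:
  fixes G :: "'v ugraph" and A :: "'v \<Rightarrow> real" and x1 x2 :: real
  assumes "simple_graph G"
  defines "U \<equiv> range_verts G A x1 x2"
  shows "range_count wedge G A x1 x2 = (\<Sum>v\<in>U. card {u \<in> U. {v, u} \<in> edges G} choose 2)"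
proof -
  have "simple_graph (induced G U)"
    using assms(1) unfolding U_def
    by (auto simp: simple_graph_def induced_def range_verts_def intro: finite_subset)
  moreover have "adjacent (induced G U) v = {u \<in> U. {v, u} \<in> edges G}" if "v \<in> U" for v
    using that by (auto simp: adjacent_def induced_def)
  moreover have "verts (induced G U) = U"
    by (simp add: induced_def)
  ultimately show ?thesis
    unfolding range_count_def U_def[symmetric] by (simp add: card_occurrences_wedge)
qed

section \<open>Passing from the input graph to ranks\<close>

definition rank_adj :: "'v ugraph \<Rightarrow> 'v list \<Rightarrow> nat \<Rightarrow> nat \<Rightarrow> bool" where
  "rank_adj G vs i j \<longleftrightarrow> i < length vs \<and> j < length vs \<and> {vs ! i, vs ! j} \<in> edges G"

lemma rank_graph_rank_adj:
  assumes G: "simple_graph G" and vs: "set vs = \<Union> (edges G)"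
  shows "rank_graph (length vs) (rank_adj G vs)"
proof
  show "rank_adj G vs v u" if "rank_adj G vs u v" for u v
    using that by (simp add: rank_adj_def insert_commute)
  show "\<not> rank_adj G vs u u" for u
    using G by (auto simp: rank_adj_def simple_graph_def)
  show "u < length vs" if "rank_adj G vs u v" for u v
    using that by (simp add: rank_adj_def)
  show "\<exists>v. rank_adj G vs u v" if "u < length vs" for u
  proof -
    have "vs ! u \<in> \<Union> (edges G)"
      using that vs nth_mem by blast
    then obtain e where e: "e \<in> edges G" "vs ! u \<in> e"
      by blast
    then have "card e = 2"
      using G by (simp add: simple_graph_def)
    with e(2) obtain y where y: "e = {vs ! u, y}"
      by (auto simp: card_2_iff)
    then have "y \<in> set vs"
      using e(1) vs by blast
    then obtain v where "v < length vs" "vs ! v = y"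
      by (auto simp: in_set_conv_nth)
    with y e(1) that show ?thesis
      unfolding rank_adj_def by blast
  qed
qed

text \<open>Each edge accounts for at most two ordered pairs of positions, one per orientation,
  because \<open>vs\<close> lists no vertex twice.\<close>

lemma card_rank_adj_le:
  assumes G: "simple_graph G" and "finite (edges G)" and vs: "distinct vs"
  shows "card {(i, j). rank_adj G vs i j} \<le> 2 * card (edges G)"
proof -
  have "card {(i, j). i < length vs \<and> j < length vs \<and> {vs ! i, vs ! j} = e} \<le> 2"
    if "e \<in> edges G" for e
  proof -
    have "card e = 2"
      using G that by (simp add: simple_graph_def)
    then obtain x y where e: "e = {x, y}"
      by (auto simp: card_2_iff)
    let ?S = "{(i, j). i < length vs \<and> j < length vs \<and> {vs ! i, vs ! j} = e}"
    have "card ?S \<le> card {(x, y), (y, x)}"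
    proof (rule card_inj_on_le)
      show "inj_on (\<lambda>(i, j). (vs ! i, vs ! j)) ?S"
        using vs by (auto simp: inj_on_def nth_eq_iff_index_eq)
      show "(\<lambda>(i, j). (vs ! i, vs ! j)) ` ?S \<subseteq> {(x, y), (y, x)}"
        by (auto simp: e doubleton_eq_iff)
    qed simp
    also have "\<dots> \<le> 2"
      by (cases "x = y") simp_all
    finally show ?thesis .
  qed
  moreover have "{(i, j). rank_adj G vs i j} =
      (\<Union>e\<in>edges G. {(i, j). i < length vs \<and> j < length vs \<and> {vs ! i, vs ! j} = e})"
    unfolding rank_adj_def by auto
  ultimately show ?thesis
    using card_UN_le[OF assms(2), of "\<lambda>e. {(i, j). i < length vs \<and> j < length vs \<and> {vs ! i, vs ! j} = e}"]
      sum_bounded_above[of "edges G" "\<lambda>e. card {(i, j). i < length vs \<and> j < length vs \<and> {vs ! i, vs ! j} = e}" 2]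
    by (simp add: mult.commute)
qed

text \<open>Counting values below \<open>x1\<close> and values up to \<open>x2\<close> puts all ties
  with the endpoints inside the half-open range of ranks. Vertices missing from \<open>vs\<close>
  are isolated and are the centre of no wedge.\<close>

lemma range_count_eq_wedges:
  assumes G: "simple_graph G" and vs: "set vs = \<Union> (edges G)" "distinct vs" "sorted (map A vs)"
  defines "N \<equiv> length vs"
  shows "range_count wedge G A x1 x2 = rank_graph.wedges (rank_adj G vs)
    {card {i. i < N \<and> map A vs ! i < x1}..<card {i. i < N \<and> map A vs ! i \<le> x2}}"
proof -
  interpret rank_graph N "rank_adj G vs"
    unfolding N_def by (rule rank_graph_rank_adj[OF G vs(1)])
  define a b where "a = card {i. i < N \<and> map A vs ! i < x1}"
    and "b = card {i. i < N \<and> map A vs ! i \<le> x2}"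
  define U where "U = range_verts G A x1 x2"
  have sub: "set vs \<subseteq> verts G"
    using G vs(1) by (auto simp: simple_graph_def)
  have fin: "finite U"
    using G by (simp add: U_def range_verts_def simple_graph_def)
  have mono: "A (vs ! i) \<le> A (vs ! j)" if "i < j" "j < N" for i j
    using sorted_nth_mono[OF vs(3), of i j] that unfolding N_def by simp
  have a: "map A vs ! i < x1 \<longleftrightarrow> i < a" if "i < N" for i
    unfolding a_def using that mono
    by (intro less_card_initial_segment_iff) (auto simp: N_def intro: le_less_trans)
  have b: "map A vs ! i \<le> x2 \<longleftrightarrow> i < b" if "i < N" for i
    unfolding b_def using that mono
    by (intro less_card_initial_segment_iff) (auto simp: N_def intro: order_trans)
  have "b \<le> N"
    unfolding b_def using card_mono[of "{..<N}" "{i. i < N \<and> map A vs ! i \<le> x2}"] by auto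
  have in_U: "vs ! i \<in> U \<longleftrightarrow> i \<in> {a..<b}" if "i < N" for i
    using a[OF that] b[OF that] sub that nth_mem[of i vs]
    by (auto simp: U_def range_verts_def N_def)
  have bij: "bij_betw ((!) vs) {a..<b} (U \<inter> set vs)"
  proof (rule bij_betw_imageI)
    show "inj_on ((!) vs) {a..<b}"
      using vs(2) \<open>b \<le> N\<close> by (auto simp: inj_on_def nth_eq_iff_index_eq N_def)
    show "(!) vs ` {a..<b} = U \<inter> set vs"
    proof (intro equalityI subsetI)
      fix v
      assume "v \<in> (!) vs ` {a..<b}"
      then obtain i where "v = vs ! i" "i \<in> {a..<b}"
        by blast
      with in_U[of i] \<open>b \<le> N\<close> show "v \<in> U \<inter> set vs"
        by (simp add: N_def)
    next
      fix v
      assume "v \<in> U \<inter> set vs"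
      then obtain i where "v = vs ! i" "i < N" "v \<in> U"
        by (auto simp: in_set_conv_nth N_def)
      with in_U[of i] show "v \<in> (!) vs ` {a..<b}"
        by blast
    qed
  qed
  have deg: "card {u \<in> U. {vs ! i, u} \<in> edges G} = deg_in {a..<b} i" if "i \<in> {a..<b}" for i
  proof -
    have "bij_betw ((!) vs) {j \<in> {a..<b}. rank_adj G vs i j} {u \<in> U. {vs ! i, u} \<in> edges G}"
    proof (rule bij_betw_subset[OF bij])
      have "i < N"
        using that \<open>b \<le> N\<close> by simp
      have "u \<in> (!) vs ` {a..<b}" if "u \<in> U" "{vs ! i, u} \<in> edges G" for u
        using that bij vs(1) unfolding bij_betw_def by blast
      then show "(!) vs ` {j \<in> {a..<b}. rank_adj G vs i j} = {u \<in> U. {vs ! i, u} \<in> edges G}"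
        using \<open>i < N\<close> \<open>b \<le> N\<close> in_U by (fastforce simp: rank_adj_def N_def)
    qed auto
    then show ?thesis
      unfolding deg_in_def by (simp add: bij_betw_same_card)
  qed
  have "(\<Sum>v\<in>U. card {u \<in> U. {v, u} \<in> edges G} choose 2) =
      (\<Sum>v\<in>U \<inter> set vs. card {u \<in> U. {v, u} \<in> edges G} choose 2)"
  proof (rule sum.mono_neutral_right[OF fin])
    show "\<forall>v\<in>U - U \<inter> set vs. (card {u \<in> U. {v, u} \<in> edges G} choose 2) = 0"
    proof
      fix v
      assume "v \<in> U - U \<inter> set vs"
      then have "{u \<in> U. {v, u} \<in> edges G} = {}"
        using vs(1) by blast
      then show "(card {u \<in> U. {v, u} \<in> edges G} choose 2) = 0"
        by (simp only: card.empty) simp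
    qed
  qed auto
  also have "\<dots> = (\<Sum>i\<in>{a..<b}. card {u \<in> U. {vs ! i, u} \<in> edges G} choose 2)"
    by (rule sum.reindex_bij_betw[OF bij, symmetric])
  also have "\<dots> = wedges {a..<b}"
    unfolding wedges_def by (rule sum.cong) (simp_all add: deg)
  finally show ?thesis
    using range_count_wedge[OF G] unfolding a_def b_def U_def by simp
qed

section \<open>Word length, space and time bounds\<close>

text \<open>The sum is below \<open>8 * X ^ 3\<close>, and \<open>8 \<le> X ^ 3\<close> since
  \<open>2 \<le> X\<close>. With \<open>X\<close> a power of two exceeding or equal to the input
  size, the exponent 6 becomes the factor in the word length.\<close>

lemma word_bound:
  fixes X N L K :: nat
  assumes "2 \<le> X" "N \<le> X" "L \<le> 2 * X" "K \<le> N + 1"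
  shows "N * N * N + N * N + N + 2 * L + 2 * K + K * K + 10 < X ^ 6"
proof -
  define Y where "Y = X * X * X"
  have sq: "4 * X \<le> Y"
    unfolding Y_def using assms(1) mult_le_mono[of 2 X 2 X] by simp
  have cube: "2 * (X * X) \<le> Y"
    unfolding Y_def using assms(1) by (simp add: mult.commute mult_le_mono1)
  have "K \<le> X + 1"
    using assms by simp
  then have "K * K \<le> (X + 1) * (X + 1)"
    by (intro mult_le_mono)
  moreover have "N * N \<le> X * X"
    using assms(2) by (intro mult_le_mono)
  moreover have "N * N * N \<le> Y"
    unfolding Y_def using assms(2) by (intro mult_le_mono)
  moreover have "(X + 1) * (X + 1) = X * X + 2 * X + 1"
    by (simp add: algebra_simps)
  ultimately have "N * N * N + N * N + N + 2 * L + 2 * K + K * K + 10 < 8 * Y"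
    using sq cube \<open>K \<le> X + 1\<close> assms by linarith
  also have "8 * Y \<le> Y * Y"
    using sq assms(1) by (intro mult_le_mono1) linarith
  also have "\<dots> = X ^ 6"
    unfolding Y_def by (simp add: numeral_eq_Suc)
  finally show ?thesis .
qed

text \<open>The constant 1348 comes from the time bound: a factor 2 for rounding \<open>lam\<close>
  up to \<open>l\<close>, times 674 for the steps per unit of \<open>l\<close> and of
  \<open>log_size G\<close>. The space bound would allow 49.\<close>

lemma wedge_structure_exists:
  fixes G :: "'v ugraph" and A :: "'v \<Rightarrow> real" and lam :: real
  assumes G: "simple_graph G" and lam: "1 \<le> lam" "lam \<le> sqrt (real (card (edges G)))"
  shows "\<exists>D. range_counting_structure wedge G A (word_length 6 G) (compile 0 query_code @ [Halt]) D
    (1348 * log_size G ^ 1 * ((real (card (edges G)))\<^sup>2 / lam\<^sup>2)) (1348 * log_size G ^ 1 * lam)"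
proof -
  define m n where "m = card (edges G)" and "n = card (verts G)"
  have fin: "finite (verts G)" "finite (edges G)"
    using G finite_subset[of "edges G" "Pow (verts G)"] by (auto simp: simple_graph_def)
  have edge: "finite e" "e \<subseteq> verts G" "card e = 2" if "e \<in> edges G" for e
    using G fin that finite_subset[of e "verts G"] by (auto simp: simple_graph_def)
  have m: "1 \<le> m"
    using lam unfolding m_def by (cases "card (edges G) = 0") auto
  have "\<Union> (edges G) \<subseteq> verts G"
    using edge(2) by blast
  then obtain xs where xs: "set xs = \<Union> (edges G)" "distinct xs"
    using fin(1) finite_distinct_list[of "\<Union> (edges G)"] by (auto dest: finite_subset)
  define vs where "vs = sort_key A xs"
  have vs: "set vs = \<Union> (edges G)" "distinct vs" "sorted (map A vs)"
    using xs by (simp_all add: vs_def)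
  define N where "N = length vs"
  have card_vs: "N = card (\<Union> (edges G))"
    using distinct_card[OF vs(2)] unfolding N_def vs(1) by simp
  have N_n: "N \<le> n"
    unfolding card_vs n_def using fin(1) \<open>\<Union> (edges G) \<subseteq> verts G\<close> by (rule card_mono)
  have N_m: "N \<le> 2 * m"
    unfolding card_vs m_def
    using card_Union_le_sum_card[of "edges G"] edge(3) by (simp add: mult.commute)
  define J where "J = nat \<lceil>log_size G\<rceil>"
  define l where "l = nat \<lceil>lam\<rceil>"
  have l: "lam \<le> l" "l \<le> 2 * lam" "0 < l"
    using lam(1) unfolding l_def by linarith+
  interpret rank_graph N "rank_adj G vs"
    unfolding N_def by (rule rank_graph_rank_adj[OF G vs(1)])
  define L K where "L = card codes" and "K = card (boundaries l)"
  have L: "L \<le> 2 * m"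
    unfolding L_def m_def card_codes by (rule card_rank_adj_le[OF G fin(2) vs(2)])
  have K_N: "K \<le> N + 1"
    unfolding K_def by (rule card_boundaries_le)
  have K_L: "K \<le> 2 + 2 * (L div l)"
    unfolding K_def L_def by (rule card_boundaries)
  have n2: "2 \<le> n"
  proof -
    obtain e where "e \<in> edges G"
      using m unfolding m_def by fastforce
    then show ?thesis
      using edge[of e] card_mono[OF fin(1), of e] unfolding n_def by simp
  qed
  \<comment> \<open>A logarithm of at least 1 lets additive constants be absorbed into the
    logarithmic factor.\<close>
  have log_ge: "1 \<le> log_size G"
    unfolding log_size_def using n2 m by (simp add: n_def m_def le_log_iff)
  have size: "n + m \<le> 2 ^ J"
  proof -
    have "log 2 (real (n + m)) \<le> real J"
      unfolding J_def log_size_def n_def m_def by linarith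
    then have "real (n + m) \<le> 2 powr real J"
      using n2 by (simp add: log_le_iff)
    then have "real (n + m) \<le> real (2 ^ J)"
      by (simp add: powr_realpow)
    then show ?thesis
      by (simp only: of_nat_le_iff)
  qed
  have J: "real J \<le> 2 * log_size G"
    using log_ge unfolding J_def by linarith
  have two: "2 \<le> (2 :: nat) ^ J"
    using size n2 by linarith
  \<comment> \<open>The three lengths sum to less than \<open>8 * 2 ^ J\<close>; hence three extra
    rounds of halving.\<close>
  interpret rank_structure N "rank_adj G vs" "word_length 6 G" "J + 3" l "map A vs"
  proof
    show "length (map A vs) = N" "sorted (map A vs)" "0 < l"
      using vs l by (simp_all add: N_def)
    have "N * N * N + N * N + N + 2 * L + 2 * K + K * K + 10 < (2 ^ J) ^ 6"
      using two size N_n L K_N by (intro word_bound) linarith+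
    also have "(2 ^ J) ^ 6 = (2 :: nat) ^ word_length 6 G"
      unfolding word_length_def J_def by (simp add: power_mult mult.commute)
    finally show "N * N * N + N * N + N + 2 * card codes + 2 * card (boundaries l) +
        card (boundaries l) * card (boundaries l) + 10 < 2 ^ word_length 6 G"
      unfolding L_def K_def .
    have "L + K + N < 8 * 2 ^ J"
      using two size N_n L K_N by linarith
    then show "card codes + card (boundaries l) + N < 2 ^ (J + 3)"
      unfolding L_def K_def by (simp add: power_add)
  qed
  \<comment> \<open>From \<open>lam\<^sup>2 \<le> m\<close> follow \<open>1 \<le> r\<close> and
    \<open>m \<le> r\<^sup>2\<close>, so the constant and linear parts of the image are also bounded
    by multiples of \<open>r\<^sup>2\<close>.\<close>
  define r where "r = real m / lam"
  have lam_sq: "lam\<^sup>2 \<le> real m"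
    using lam real_le_lsqrt[of lam] power_mono[of lam "sqrt (real m)" 2] unfolding m_def by simp
  have r1: "1 \<le> r"
  proof -
    have "lam * 1 \<le> lam\<^sup>2"
      unfolding power2_eq_square using lam(1) by (intro mult_left_mono) auto
    then show ?thesis
      using lam_sq lam(1) unfolding r_def by simp
  qed
  have m_r: "real m \<le> r\<^sup>2"
  proof -
    have "real m * lam\<^sup>2 \<le> real m * real m"
      using lam_sq by (intro mult_left_mono) auto
    then show ?thesis
      using lam(1) unfolding r_def by (simp add: power_divide field_simps power2_eq_square)
  qed
  have K_r: "real K \<le> 6 * r"
  proof -
    have "real (L div l) \<le> real L / real l"
      by (rule of_nat_div_le_of_nat)
    also have "\<dots> \<le> real (2 * m) / lam"
      using L l lam(1) by (intro frac_le) auto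
    also have "\<dots> = 2 * r"
      unfolding r_def by simp
    finally show ?thesis
      using K_L r1 by linarith
  qed
  have "real (space structure_image) \<le> 1348 * log_size G * r\<^sup>2"
  proof -
    have "real K * real K \<le> 6 * r * (6 * r)"
      using K_r r1 by (intro mult_mono) auto
    moreover have "r \<le> r\<^sup>2" "1 \<le> r\<^sup>2"
      using r1 self_le_power[of r 2] one_le_power[of r 2] by simp_all
    moreover have "real (space structure_image) = 3 + real L + real K + real K * real K + real N"
      by (simp add: space_def length_words_image L_def K_def N_def[symmetric])
    moreover have "real L \<le> 2 * real m" "real N \<le> 2 * real m"
      using L N_m by linarith+
    \<comment> \<open>The coefficients are 3 for the header, 2 for the codes, 6 for the boundaries,
      36 for the table and 2 for the reals.\<close>
    ultimately have "real (space structure_image) \<le> 49 * r\<^sup>2"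
      using K_r m_r by (simp add: power2_eq_square)
    also have "\<dots> \<le> 1348 * log_size G * r\<^sup>2"
      using log_ge by (intro mult_right_mono) auto
    finally show ?thesis .
  qed
  moreover have "answers (word_length 6 G) (compile 0 query_code @ [Halt]) structure_image x1 x2
      (1348 * log_size G * lam) (range_count wedge G A x1 x2)" if "x1 \<le> x2" for x1 x2
  proof (rule wp_answers, rule wp_mono[OF wp_query_code[OF that]])
    fix t :: nat and R X
    assume *: "t \<le> l * (106 * (J + 3) + 144) \<and> R 0 =
      wedges {card {i. i < N \<and> map A vs ! i < x1}..<card {i. i < N \<and> map A vs ! i \<le> x2}}"
    have "real t \<le> real (l * (106 * (J + 3) + 144))"
      using * by (simp only: of_nat_le_iff)
    also have "\<dots> = real l * (106 * (real J + 3) + 144)"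
      by simp
    \<comment> \<open>Here \<open>674 = 106 * 2 + 106 * 3 + 144\<close>, where the factor 2 bounds
      \<open>J\<close> by \<open>2 * log_size G\<close>.\<close>
    also have "\<dots> \<le> (2 * lam) * (674 * log_size G)"
      using l lam(1) J log_ge by (intro mult_mono) auto
    finally show "real t \<le> 1348 * log_size G * lam \<and> R 0 = range_count wedge G A x1 x2"
      using * range_count_eq_wedges[OF G vs] unfolding N_def by (simp add: mult_ac)
  qed
  moreover have "valid_image (word_length 6 G) structure_image"
    unfolding valid_image_def using words_image_less by simp
  ultimately have "range_counting_structure wedge G A (word_length 6 G)
      (compile 0 query_code @ [Halt]) structure_image
      (1348 * log_size G ^ 1 * ((real (card (edges G)))\<^sup>2 / lam\<^sup>2)) (1348 * log_size G ^ 1 * lam)"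
    unfolding range_counting_structure_def by (simp add: r_def m_def power_divide)
  then show ?thesis
    by blast
qed

theorem theorem1:
  "\<exists>(P :: program) (c :: nat) (C :: real) (k :: nat).
     \<forall>(G :: 'v ugraph) (A :: 'v \<Rightarrow> real) (lam :: real).
       simple_graph G \<longrightarrow> 1 \<le> lam \<longrightarrow> lam \<le> sqrt (real (card (edges G))) \<longrightarrow>
       (\<exists>D. range_counting_structure wedge G A (word_length c G) P D
              (C * log_size G ^ k * ((real (card (edges G)))\<^sup>2 / lam\<^sup>2))
              (C * log_size G ^ k * lam))"
  using wedge_structure_exists by blast

end
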